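(* Let $T>0$, let $[a,b]\subset(0,1)$, let $\alpha\in C^{1}([0,T];[a,b])$, and let $0<\epsilon<1-\alpha^{*}$. Assume that for some $p>1$, $$(\alpha_{*}+\epsilon-\alpha(0))\,p>-1 .$$ Then for every $g\in\mathcal{C}_{0}^{\alpha(\cdot)+\epsilon}([0,T];\mathbb{R})$ the multifractional derivative $D_{0+}^{\alpha}g$ can be represented in $L^{p}([0,T])$ as $$D_{0+}^{\alpha}g(x)=G_{0}(g)(x)+\sum_{m=1}^{\infty}\int_{0<s_{m}<\dots<s_{1}<x}G_{0}(g)(s_{m})\,F(s_{m},s_{m-1})\cdots F(s_{2},s_{1})\,F(s_{1},x)\,ds_{m}\cdots ds_{1}$$ (for $m=1$ the integrand is $G_0(g)(s_1)F(s_1,x)$). Furthermore, $$|D_{0+}^{\alpha}g(x)|\le C(T,\epsilon,\alpha;x)\,\|g\|_{\alpha(\cdot)+\epsilon;[0,T]},$$ where $C(T,\epsilon,\alpha;\cdot)$ is a function on $[0,T]$ not depending on $g$, which belongs to $L^{p}([0,T])$ for any $p>1$ satisfying the inequality $(\alpha_{*}+\epsilon-\alpha(0))p>-1$; hence $D_{0+}^{\alpha}g\in L^{p}([0,T])$.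
   Context: Notation: $\alpha_{*}=\inf_{t\in[0,T]}\alpha(t)$, $\alpha^{*}=\sup_{t\in[0,T]}\alpha(t)$; $\Gamma$ and $B(\cdot,\cdot)$ are the Gamma and Beta functions. For a $C^1$ function $\beta:[0,T]\to(0,1)$ with values in a compact subinterval of $(0,1)$, $\mathcal{C}^{\beta(\cdot)}([0,T];\mathbb{R})$ is the space of functions $f:[0,T]\to\mathbb{R}$ with $$\|f\|_{\beta(\cdot);[0,T]}:=|f(0)|+\sup_{x\neq y\in[0,T]}\frac{|f(x)-f(y)|}{|x-y|^{\max(\beta(x),\beta(y))}}<\infty,$$ and $\mathcal{C}_{0}^{\beta(\cdot)}([0,T];\mathbb{R})$ is its subspace of functions with $f(0)=0$. It is used here with $\beta=\alpha+\epsilon$. Define $$G_{0}(g)(x)=\frac{1}{B(\alpha(x),1-\alpha(x))}\frac{d}{dx}\left(\int_{0}^{x}\frac{\Gamma(\alpha(t))g(t)}{(x-t)^{\alpha(t)}}\,dt\right),$$ and, for $0\le s<x\le T$, $$F(s,x)=-\frac{1}{B(\alpha(x),1-\alpha(x))}\int_{0}^{1}\alpha'(s+\tau(x-s))\,\bigl(\ln\tau-\ln(1-\tau)\bigr)\left(\frac{\tau}{1-\tau}\right)^{\alpha(s+\tau(x-s))}d\tau .$$ The multifractional derivative $D_{0+}^{\alpha}g$ of $g\in\mathcal{C}_{0}^{\alpha(\cdot)+\epsilon}([0,T];\mathbb{R})$ is defined as the unique solution $f\in L^{p}([0,T])$ of the integral equation $$f(x)=G_{0}(g)(x)+\int_{0}^{x}f(s)F(s,x)\,ds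 .$$ *)

theory Defs
  imports "HOL-Analysis.Analysis"
begin

text \<open>
  Functions on \<open>[0,T]\<close> are total functions on the reals of which only the values on
  \<open>{0..T}\<close> matter; accordingly all derivatives are taken within \<open>{0..T}\<close>, hence are
  one-sided at the two endpoints.
\<close>

definition deriv_on :: "real \<Rightarrow> (real \<Rightarrow> real) \<Rightarrow> real \<Rightarrow> real" where
  "deriv_on T f x = vector_derivative f (at x within {0..T})"

definition C1_on :: "real \<Rightarrow> (real \<Rightarrow> real) \<Rightarrow> bool" where
  "C1_on T f \<longleftrightarrow>
     f differentiable_on {0..T} \<and> continuous_on {0..T} (deriv_on T f)"

definition holder_quotients :: "(real \<Rightarrow> real) \<Rightarrow> real \<Rightarrow> (real \<Rightarrow> real) \<Rightarrow> real set" where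
  "holder_quotients \<beta> T f =
     {\<bar>f x - f y\<bar> / \<bar>x - y\<bar> powr max (\<beta> x) (\<beta> y) | x y.
        x \<in> {0..T} \<and> y \<in> {0..T} \<and> x \<noteq> y}"

definition holder_norm :: "(real \<Rightarrow> real) \<Rightarrow> real \<Rightarrow> (real \<Rightarrow> real) \<Rightarrow> real" where
  "holder_norm \<beta> T f = \<bar>f 0\<bar> + Sup (holder_quotients \<beta> T f)"

definition holder_space :: "(real \<Rightarrow> real) \<Rightarrow> real \<Rightarrow> (real \<Rightarrow> real) set" where
  "holder_space \<beta> T = {f. bdd_above (holder_quotients \<beta> T f)}"

definition holder_space0 :: "(real \<Rightarrow> real) \<Rightarrow> real \<Rightarrow> (real \<Rightarrow> real) set" where
  "holder_space0 \<beta> T = {f \<in> holder_space \<beta> T. f 0 = 0}"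

definition in_Lp :: "real \<Rightarrow> real \<Rightarrow> (real \<Rightarrow> real) \<Rightarrow> bool" where
  "in_Lp p T f \<longleftrightarrow>
     f \<in> borel_measurable (lebesgue_on {0..T}) \<and>
     integrable (lebesgue_on {0..T}) (\<lambda>x. \<bar>f x\<bar> powr p)"

definition Lp_norm :: "real \<Rightarrow> real \<Rightarrow> (real \<Rightarrow> real) \<Rightarrow> real" where
  "Lp_norm p T f = (LINT x|lebesgue_on {0..T}. \<bar>f x\<bar> powr p) powr (1 / p)"

definition Lp_sums :: "real \<Rightarrow> real \<Rightarrow> (nat \<Rightarrow> real \<Rightarrow> real) \<Rightarrow> (real \<Rightarrow> real) \<Rightarrow> bool" where
  "Lp_sums p T u f \<longleftrightarrow>
     (\<forall>n. in_Lp p T (u n)) \<and> in_Lp p T f \<and>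
     (\<lambda>N. Lp_norm p T (\<lambda>x. f x - (\<Sum>n<N. u n x))) \<longlonglongrightarrow> 0"

definition singular_integral :: "(real \<Rightarrow> real) \<Rightarrow> (real \<Rightarrow> real) \<Rightarrow> real \<Rightarrow> real" where
  "singular_integral \<alpha> g x =
     (LINT t:{0..x}|lebesgue. Gamma (\<alpha> t) * g t / (x - t) powr \<alpha> t)"

definition G0 :: "real \<Rightarrow> (real \<Rightarrow> real) \<Rightarrow> (real \<Rightarrow> real) \<Rightarrow> real \<Rightarrow> real" where
  "G0 T \<alpha> g x =
     1 / Beta (\<alpha> x) (1 - \<alpha> x) * deriv_on T (singular_integral \<alpha> g) x"

definition F_kernel :: "real \<Rightarrow> (real \<Rightarrow> real) \<Rightarrow> real \<Rightarrow> real \<Rightarrow> real" where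
  "F_kernel T \<alpha> s x =
     - (1 / Beta (\<alpha> x) (1 - \<alpha> x)) *
     (LINT \<tau>:{0<..<1}|lebesgue.
        deriv_on T \<alpha> (s + \<tau> * (x - s)) * (ln \<tau> - ln (1 - \<tau>)) *
        (\<tau> / (1 - \<tau>)) powr \<alpha> (s + \<tau> * (x - s)))"

definition multifractional_solution ::
  "real \<Rightarrow> (real \<Rightarrow> real) \<Rightarrow> real \<Rightarrow> (real \<Rightarrow> real) \<Rightarrow> (real \<Rightarrow> real) \<Rightarrow> bool" where
  "multifractional_solution T \<alpha> p g f \<longleftrightarrow>
     in_Lp p T f \<and>
     (AE x in lebesgue_on {0..T}.
        f x = G0 T \<alpha> g x + (LINT s:{0..x}|lebesgue. f s * F_kernel T \<alpha> s x))"

text \<open>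
  Elements of \<open>L\<^sup>p\<close> are classes modulo equality almost everywhere, so the solution of the
  integral equation can only be unique up to null sets; we choose a representative.
\<close>

definition multifractional_deriv ::
  "real \<Rightarrow> (real \<Rightarrow> real) \<Rightarrow> real \<Rightarrow> (real \<Rightarrow> real) \<Rightarrow> real \<Rightarrow> real" where
  "multifractional_deriv T \<alpha> p g = (SOME f. multifractional_solution T \<alpha> p g f)"

text \<open>
  The \<open>m\<close>-fold integrals (\<open>m \<ge> 1\<close>) are taken with respect to \<open>m\<close>-dimensional Lebesgue
  measure, a point being a function \<open>s\<close> on the index set \<open>{1..m}\<close>.
\<close>

definition decreasing_simplex :: "nat \<Rightarrow> real \<Rightarrow> (nat \<Rightarrow> real) set" where
  "decreasing_simplex m x =
     {s. 0 < s m \<and> (\<forall>i\<in>{1..<m}. s (Suc i) < s i) \<and> s 1 < x}"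

definition series_integrand ::
  "real \<Rightarrow> (real \<Rightarrow> real) \<Rightarrow> (real \<Rightarrow> real) \<Rightarrow> nat \<Rightarrow> real \<Rightarrow> (nat \<Rightarrow> real) \<Rightarrow> real" where
  "series_integrand T \<alpha> g m x s =
     G0 T \<alpha> g (s m) * (\<Prod>i\<in>{1..<m}. F_kernel T \<alpha> (s (Suc i)) (s i)) * F_kernel T \<alpha> (s 1) x"

definition series_term ::
  "real \<Rightarrow> (real \<Rightarrow> real) \<Rightarrow> (real \<Rightarrow> real) \<Rightarrow> nat \<Rightarrow> real \<Rightarrow> real" where
  "series_term T \<alpha> g m x =
     (LINT s:decreasing_simplex m x|Pi\<^sub>M {1..m} (\<lambda>_. lborel). series_integrand T \<alpha> g m x s)"

end

(*
  The derivative in G0 can be carried out under the integral after subtracting the diagonal: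
  with H(t,u) = Gamma(alpha t) g(t) u^(-alpha t) and P = -dH/du,
    d/dx int_0^x H(t, x - t) dt = H(x,T) + int_0^T (P(x,u) - P(x - u,u)) du   (0 <= x <= T),
  where alpha is extended by constants and g by 0 to the left of 0. The regularity
  alpha(.) + epsilon of g and the Lipschitz continuity of alpha bound the difference by
  c |g| (u^(epsilon - 1) + u^(-(1+b)/2)), which is integrable. Hence G0(g) is continuous on the
  closed interval and bounded by a constant multiple of the norm of g. The kernel F is bounded on
  the square, so the integral equation is of Volterra type with bounded data: the Neumann series
  converges uniformly, iterating the equation gives uniqueness in L^p, and C may be taken constant.
*)

theory Submission
  imports Defs
begin

section \<open>Differentiating a convolution with a non-integrable derivative\<close>

text \<open>Differentiating int_0^x H(t, x - t) dt under the integral sign produces P(t, x - t), and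
  P(t,u) has order u^(-alpha(t) - 1), which is in general not integrable at u = 0. No difference
  quotient is therefore estimated: the claimed derivative is integrated over [0,x], and Fubini
  recovers the convolution. As the claimed derivative is continuous, the fundamental theorem gives
  differentiability at every point, endpoints included. The exponent (1+b)/2 is the midpoint of b
  and 1. Varying s in u^(-s-1) produces a factor ln u; the gap between b and the midpoint absorbs
  it, and the gap between the midpoint and 1 keeps the result integrable. The kernel is set to zero
  outside 0 < s < x <= T. All integrals then run over the whole line or a whole product space, the
  simplex being enforced by vanishing factors, and the multiple integrals become iterates of one
  operator. The multifractional derivative is a chosen representative, so the series and the
  pointwise bound are proved for the Neumann sum and carried over by uniqueness almost
  everywhere.\<close>

lemma integrable_lborel_pair_mult:
  fixes f g :: "real \<Rightarrow> real"
  assumes f: "integrable lborel f" and g: "integrable lborel g"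
  shows "integrable (lborel \<Otimes>\<^sub>M lborel) (\<lambda>(x, y). f x * g y)"
proof (rule lborel_pair.Fubini_integrable)
  have [measurable]: "f \<in> borel_measurable borel" "g \<in> borel_measurable borel"
    using f g by (auto dest: borel_measurable_integrable)
  show "(\<lambda>(x, y). f x * g y) \<in> borel_measurable (lborel \<Otimes>\<^sub>M lborel)"
    by measurable
  show "integrable lborel (\<lambda>x. LBINT y. norm (case (x, y) of (x, y) \<Rightarrow> f x * g y))"
    using f by (simp add: abs_mult)
  show "AE x in lborel. integrable lborel (\<lambda>y. case (x, y) of (x, y) \<Rightarrow> f x * g y)"
    using g by simp
qed

lemma set_integrable_lborel_powr:
  fixes c r :: real
  assumes "c > -1" "0 \<le> r"
  shows "set_integrable lborel {0<..r} (\<lambda>u. u powr c)"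
proof -
  have "set_integrable lebesgue {0<..r} (\<lambda>u. u powr c)"
    using assms by (intro nonnegative_absolutely_integrable_1 integrable_on_powr_from_0') auto
  then show ?thesis
    unfolding set_integrable_def by (subst (asm) integrable_completion) auto
qed

text \<open>\<open>P_bound\<close> admits a singularity of order above 1, so the integral in
  \<open>D\<close> converges only through the majorant \<open>\<Psi>\<close> of the difference.
  \<open>P_zero\<close> removes what the substitution t = y - u would leave over negative t. The
  identity comes from integrating \<open>D\<close>, the derivative from continuity of
  \<open>D\<close>.\<close>

lemma singular_convolution_derivative:
  fixes H P :: "real \<Rightarrow> real \<Rightarrow> real" and \<Psi> :: "real \<Rightarrow> real" and T C \<kappa> :: real
  assumes T: "0 < T" and \<kappa>: "0 < \<kappa>" "\<kappa> < 1"
    and deriv_H: "\<And>t u. 0 < u \<Longrightarrow> ((\<lambda>u. H t u) has_real_derivative - P t u) (at u)"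
    and cont_H: "continuous_on UNIV (\<lambda>t. H t T)"
    and cont_P: "continuous_on (UNIV \<times> {0<..}) (\<lambda>(t, u). P t u)"
    and P_zero: "\<And>t u. t \<le> 0 \<Longrightarrow> P t u = 0"
    and P_bound: "\<And>t u. u \<in> {0<..T} \<Longrightarrow> \<bar>P t u\<bar> \<le> C * u powr (- 2 * \<kappa>)"
    and \<Psi>: "set_integrable lborel {0<..T} \<Psi>"
    and P_diff: "\<And>y u. u \<in> {0<..T} \<Longrightarrow> \<bar>P y u - P (y - u) u\<bar> \<le> \<Psi> u"
  defines "D \<equiv> \<lambda>y. H y T + (LBINT u:{0<..T}. P y u - P (y - u) u)"
  shows "continuous_on {0..T} D"
    and "x \<in> {0..T} \<Longrightarrow>
      ((\<lambda>x. LBINT t:{0..<x}. H t (x - t)) has_vector_derivative D x) (at x within {0..T})"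
proof -
  \<comment> \<open>Continuity of \<open>P\<close> is available only for u > 0; cutting off in u
    gives a function that is Borel on the whole plane.\<close>
  define p where "p t u = (if u \<in> {0<..T} then P t u else 0)" for t u
  define \<psi> where "\<psi> u = indicator {0<..T} u * \<Psi> u" for u
  define \<phi> where "\<phi> y u = p y u - p (y - u) u" for y u
  have "continuous_on (UNIV \<times> {0<..T}) (\<lambda>(t, u). P t u)"
    by (rule continuous_on_subset[OF cont_P]) auto
  then have "(\<lambda>z. indicator (UNIV \<times> {0<..T}) z *\<^sub>R (case z of (t, u) \<Rightarrow> P t u)) \<in> borel_measurable borel"
    by (intro borel_measurable_continuous_on_indicator) (auto intro!: borel_Times)
  moreover have "(\<lambda>z. indicator (UNIV \<times> {0<..T}) z *\<^sub>R (case z of (t, u) \<Rightarrow> P t u)) = (\<lambda>(t, u). p t u)"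
    by (auto simp: p_def fun_eq_iff)
  ultimately have p_meas [measurable]: "(\<lambda>(t, u). p t u) \<in> borel_measurable (borel \<Otimes>\<^sub>M borel)"
    by (simp add: borel_prod)
  have \<phi>_meas [measurable]: "(\<lambda>(t, u). \<phi> t u) \<in> borel_measurable (borel \<Otimes>\<^sub>M borel)"
    unfolding \<phi>_def by measurable
  have \<psi>: "integrable lborel \<psi>"
    using \<Psi> by (simp add: set_integrable_def \<psi>_def[abs_def])
  have \<phi>_bound: "\<bar>\<phi> y u\<bar> \<le> \<psi> u" for y u
    using P_diff[of u y] by (auto simp: \<phi>_def p_def \<psi>_def)
  have D_eq: "D y = H y T + (LBINT u. \<phi> y u)" for y
    unfolding D_def set_lebesgue_integral_def
    by (intro arg_cong2[where f = "(+)"] refl Bochner_Integration.integral_cong)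
       (auto simp: \<phi>_def p_def)

  have cont_P1: "continuous_on UNIV (\<lambda>t. P t u)" if "0 < u" for u
    using continuous_on_compose2[OF cont_P, of UNIV "\<lambda>t. (t, u)"] that
    by (auto simp: continuous_on_Pair image_subset_iff)
  have "continuous_on UNIV (\<lambda>y. LBINT u. \<phi> y u)"
    unfolding continuous_on_sequentially
  proof (intro allI ballI impI, elim conjE)
    fix Y :: "nat \<Rightarrow> real" and y assume Y: "Y \<longlonglongrightarrow> y"
    have "(\<lambda>n. LBINT u. \<phi> (Y n) u) \<longlonglongrightarrow> (LBINT u. \<phi> y u)"
    proof (rule integral_dominated_convergence[OF _ _ \<psi>])
      have "(\<lambda>n. \<phi> (Y n) u) \<longlonglongrightarrow> \<phi> y u" for u
      proof (cases "u \<in> {0<..T}")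
        case True
        have "isCont (\<lambda>t. P t u) t" for t
          using cont_P1[of u] True by (simp add: continuous_on_eq_continuous_at)
        then have "(\<lambda>n. P (Y n) u - P (Y n - u) u) \<longlonglongrightarrow> P y u - P (y - u) u"
          by (intro tendsto_diff isCont_tendsto_compose[of _ "\<lambda>t. P t u"] Y tendsto_const)
        then show ?thesis using True by (simp add: \<phi>_def p_def)
      next
        case False
        then have "\<phi> z u = 0" for z by (auto simp: \<phi>_def p_def)
        then show ?thesis by simp
      qed
      then show "AE u in lborel. (\<lambda>n. \<phi> (Y n) u) \<longlonglongrightarrow> \<phi> y u" by simp
    qed (use \<phi>_bound in auto)
    then show "((\<lambda>y. LBINT u. \<phi> y u) \<circ> Y) \<longlonglongrightarrow> (LBINT u. \<phi> y u)"
      by (simp add: o_def)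
  qed
  then have cont_D': "continuous_on UNIV D"
    unfolding D_eq[abs_def] by (intro continuous_on_add cont_H)
  then show cont_D: "continuous_on {0..T} D"
    by (rule continuous_on_subset) auto

  have integral_eq: "(LBINT t:{0..<x}. H t (x - t)) = integral {0..x} D" if x: "x \<in> {0..T}" for x
  proof -
    define q where "q t u = (if 0 \<le> t \<and> t < x \<and> x - t \<le> u then p t u else 0)" for t u
    have q_meas [measurable]: "(\<lambda>(t, u). q t u) \<in> borel_measurable (borel \<Otimes>\<^sub>M borel)"
      unfolding q_def by measurable

    have int1: "integrable (lborel \<Otimes>\<^sub>M lborel) (\<lambda>(y, u). indicator {0..<x} y * \<phi> y u)"
    proof (rule Bochner_Integration.integrable_bound)
      show "integrable (lborel \<Otimes>\<^sub>M lborel) (\<lambda>(y, u). indicator {0..<x} y * \<psi> u)"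
        using x by (intro integrable_lborel_pair_mult \<psi> integrable_real_indicator) auto
      show "AE z in lborel \<Otimes>\<^sub>M lborel. norm (case z of (y, u) \<Rightarrow> indicator {0..<x} y * \<phi> y u)
          \<le> norm (case z of (y, u) \<Rightarrow> indicator {0..<x} y * \<psi> u)"
        using \<phi>_bound by (intro AE_I2) (auto simp: indicator_def intro: order_trans[OF _ abs_ge_self])
    qed measurable
    have int2: "integrable (lborel \<Otimes>\<^sub>M lborel) (\<lambda>(t, u). q t u)"
    proof (rule Bochner_Integration.integrable_bound)
      let ?g = "\<lambda>u. indicator {0<..T} u *\<^sub>R u powr (- \<kappa>)"
      have g: "integrable lborel ?g"
        using set_integrable_lborel_powr[of "- \<kappa>" T] \<kappa> T by (simp add: set_integrable_def)
      show "integrable (lborel \<Otimes>\<^sub>M lborel) (\<lambda>(t, u). (C * ?g (x + (-1) * t)) * ?g u)"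
        by (intro integrable_lborel_pair_mult g integrable_mult_right lborel_integrable_real_affine) auto
      have "\<bar>q t u\<bar> \<le> (C * ?g (x + (-1) * t)) * ?g u" for t u
      proof (cases "0 \<le> t \<and> t < x \<and> x - t \<le> u \<and> u \<le> T")
        case True
        then have u: "u \<in> {0<..T}" by auto
        \<comment> \<open>At t = 0 the bounded quantity is 0 by \<open>P_zero\<close>, which fixes
          the sign of \<open>C\<close>.\<close>
        have "0 \<le> C * u powr (- 2 * \<kappa>)" using P_bound[OF u, of 0] by (auto simp: P_zero)
        then have C: "0 \<le> C" using u by (simp add: zero_le_mult_iff)
        \<comment> \<open>Half of the singularity is moved from \<open>u\<close> to \<open>x - t \<le> u\<close>, which leaves a product of
          two integrable functions.\<close>
        have "u powr (- 2 * \<kappa>) = u powr (- \<kappa>) * u powr (- \<kappa>)"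
          by (simp add: powr_add[symmetric])
        also have "\<dots> \<le> (x - t) powr (- \<kappa>) * u powr (- \<kappa>)"
          using True \<kappa> by (intro mult_right_mono powr_mono2') auto
        finally have "C * u powr (- 2 * \<kappa>) \<le> C * ((x - t) powr (- \<kappa>) * u powr (- \<kappa>))"
          using C by (rule mult_left_mono)
        with P_bound[OF u, of t] show ?thesis
          using True u x by (simp add: q_def p_def)
      next
        case False
        have "0 \<le> C * T powr (- 2 * \<kappa>)" using P_bound[of T 0] T by (auto simp: P_zero)
        then have C: "0 \<le> C" using T by (simp add: zero_le_mult_iff)
        from False have "q t u = 0" by (auto simp: q_def p_def)
        then show ?thesis using C by simp
      qed
      then show "AE z in lborel \<Otimes>\<^sub>M lborel. norm (case z of (t, u) \<Rightarrow> q t u)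
          \<le> norm (case z of (t, u) \<Rightarrow> (C * ?g (x + (-1) * t)) * ?g u)"
        by (intro AE_I2) (auto intro: order_trans[OF _ abs_ge_self])
    qed measurable

    have p_int: "integrable lborel (\<lambda>y. indicator {0..<x} y * p (y + c) u)" for c u
    proof (rule Bochner_Integration.integrable_bound)
      show "integrable lborel (\<lambda>y. (C * u powr (- 2 * \<kappa>)) * indicator {0..<x} y)"
        using x by (intro integrable_mult_right integrable_real_indicator) auto
      show "AE y in lborel. norm (indicator {0..<x} y * p (y + c) u)
          \<le> norm (C * u powr (- 2 * \<kappa>) * indicator {0..<x} y)"
        using P_bound[of u] by (intro AE_I2) (auto simp: p_def indicator_def intro: order_trans[OF _ abs_ge_self])
    qed measurable

    \<comment> \<open>Substituting \<open>t = y - u\<close> in the second half of \<open>\<phi>\<close> cancels everything but \<open>x - u \<le> t < x\<close>;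
      on that strip the integral over \<open>u\<close>, taken first, is elementary.\<close>
    have inner1: "(LBINT y. indicator {0..<x} y * \<phi> y u) = (LBINT t. q t u)" for u
    proof (cases "u \<in> {0<..T}")
      case True
      have "(LBINT y. indicator {0..<x} y * \<phi> y u)
          = (LBINT y. indicator {0..<x} y * p y u) - (LBINT y. indicator {0..<x} y * p (y - u) u)"
        using p_int[of 0 u] p_int[of "- u" u]
        by (subst Bochner_Integration.integral_diff[symmetric]) (simp_all add: \<phi>_def algebra_simps)
      also have "(LBINT y. indicator {0..<x} y * p (y - u) u) = (LBINT t. indicator {0..<x} (u + t) * p t u)"
        by (subst lborel_integral_real_affine[of 1 _ u]) simp_all
      also have "(LBINT y. indicator {0..<x} y * p y u) - \<dots>
          = (LBINT t. indicator {0..<x} t * p t u - indicator {0..<x} (u + t) * p t u)"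
        using p_int[of 0 u] lborel_integrable_real_affine[OF p_int[of "- u" u], of 1 u]
        by (subst Bochner_Integration.integral_diff[symmetric]) simp_all
      also have "\<dots> = (LBINT t. q t u)"
        using True
        by (intro Bochner_Integration.integral_cong refl)
          (auto simp: q_def p_def P_zero indicator_def not_le not_less)
      finally show ?thesis .
    next
      case False
      then have "p t u = 0" for t by (auto simp: p_def)
      then have "\<phi> t u = 0" "q t u = 0" for t by (simp_all add: \<phi>_def q_def)
      then show ?thesis by simp
    qed

    have inner2: "(LBINT u. q t u) = indicator {0..<x} t * (H t (x - t) - H t T)" for t
    proof (cases "t \<in> {0..<x}")
      case True
      then have le: "0 < x - t" "x - t \<le> T" using x by auto
      have "(LBINT u. q t u) = (LBINT u. indicator {x - t..T} u *\<^sub>R P t u)"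
        using True le by (intro Bochner_Integration.integral_cong refl) (auto simp: q_def p_def)
      also have "\<dots> = (- H t T) - (- H t (x - t))"
      proof (rule integral_FTC_Icc[OF le(2)])
        fix u assume "x - t \<le> u" "u \<le> T"
        then have "0 < u" using le by simp
        from DERIV_minus[OF deriv_H[OF this, of t]]
        show "((\<lambda>u. - H t u) has_vector_derivative P t u) (at u within {x - t..T})"
          by (simp add: has_real_derivative_iff_has_vector_derivative[symmetric] has_field_derivative_at_within)
      next
        have "continuous_on {x - t..T} (\<lambda>u. (\<lambda>(t, u). P t u) (t, u))"
          using le by (intro continuous_on_compose2[OF cont_P]) (auto intro!: continuous_intros)
        then show "continuous_on {x - t..T} (P t)" by simp
      qed
      finally show ?thesis using True by simp
    next
      case False
      then have "q t u = 0" for u by (auto simp: q_def)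
      with False show ?thesis by simp
    qed

    have HT: "integrable lborel (\<lambda>t. indicator {0..<x} t * H t T)"
    proof -
      have "set_integrable lborel {0..x} (\<lambda>t. H t T)"
        by (rule borel_integrable_atLeastAtMost') (rule continuous_on_subset[OF cont_H], simp)
      then have "set_integrable lborel {0..<x} (\<lambda>t. H t T)"
        by (rule set_integrable_subset) auto
      then show ?thesis by (simp add: set_integrable_def)
    qed
    have diff: "integrable lborel (\<lambda>t. indicator {0..<x} t * (H t (x - t) - H t T))"
      using lborel_pair.integrable_fst[OF int2] by (simp add: inner2)
    have "(LBINT y. indicator {0..<x} y * (LBINT u. \<phi> y u)) = (LBINT u. LBINT y. indicator {0..<x} y * \<phi> y u)"
      using lborel_pair.Fubini_integral[OF int1] by simp
    also have "\<dots> = (LBINT t. LBINT u. q t u)"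
      unfolding inner1 by (rule lborel_pair.Fubini_integral[OF int2])
    also have "\<dots> = (LBINT t. indicator {0..<x} t * (H t (x - t) - H t T))"
      by (simp only: inner2)
    finally have "(LBINT y. indicator {0..<x} y * H y T) + (LBINT y. indicator {0..<x} y * (LBINT u. \<phi> y u))
       = (LBINT t. indicator {0..<x} t * H t T + indicator {0..<x} t * (H t (x - t) - H t T))"
      using HT diff by simp
    also have "\<dots> = (LBINT t:{0..<x}. H t (x - t))"
      unfolding set_lebesgue_integral_def
      by (intro Bochner_Integration.integral_cong) (auto simp: algebra_simps)
    also have "(LBINT y. indicator {0..<x} y * H y T) + (LBINT y. indicator {0..<x} y * (LBINT u. \<phi> y u))
       = (LBINT y. indicator {0..<x} y * H y T + indicator {0..<x} y * (LBINT u. \<phi> y u))"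
      using lborel_pair.integrable_fst[OF int1] HT by (subst Bochner_Integration.integral_add) simp_all
    \<comment> \<open>So far the interval was half-open, to keep \<open>H\<close> away from u = 0 at
      t = x; the fundamental theorem wants the closed one, which differs by a null set.\<close>
    also have "\<dots> = (LBINT y:{0..x}. D y)"
      unfolding set_lebesgue_integral_def
    proof (rule integral_cong_AE)
      show "AE y in lborel. indicator {0..<x} y * H y T + indicator {0..<x} y * (LBINT u. \<phi> y u)
          = indicator {0..x} y *\<^sub>R D y"
        using AE_lborel_singleton[of x] by eventually_elim (auto simp: D_eq indicator_def algebra_simps)
      have [measurable]: "D \<in> borel_measurable borel" "(\<lambda>t. H t T) \<in> borel_measurable borel"
        using cont_D' cont_H by (auto intro: borel_measurable_continuous_onI)
      show "(\<lambda>y. indicator {0..<x} y * H y T + indicator {0..<x} y * (LBINT u. \<phi> y u)) \<in> borel_measurable lborel"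
        by measurable
      show "(\<lambda>y. indicator {0..x} y *\<^sub>R D y) \<in> borel_measurable lborel"
        by measurable
    qed
    also have "\<dots> = integral {0..x} D"
      by (intro set_borel_integral_eq_integral borel_integrable_atLeastAtMost' continuous_on_subset[OF cont_D']) auto
    finally show ?thesis by simp
  qed
  show "((\<lambda>x. LBINT t:{0..<x}. H t (x - t)) has_vector_derivative D x) (at x within {0..T})"
    if x: "x \<in> {0..T}"
    by (rule has_vector_derivative_transform[OF x integral_eq integral_has_vector_derivative[OF cont_D x]])
qed

section \<open>Weakly singular integrals of variable order\<close>

lemma continuous_on_Icc_bounded:
  fixes f :: "real \<Rightarrow> real"
  assumes "continuous_on {a..b} f"
  obtains W where "0 \<le> W" "\<And>s. s \<in> {a..b} \<Longrightarrow> \<bar>f s\<bar> \<le> W"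
proof -
  have "bounded (f ` {a..b})"
    using assms by (intro compact_imp_bounded compact_continuous_image) auto
  then obtain W where W: "\<And>s. s \<in> {a..b} \<Longrightarrow> \<bar>f s\<bar> \<le> W"
    unfolding bounded_iff real_norm_def by blast
  show ?thesis
    by (rule that[of "max 0 W"]) (use W in \<open>auto intro: order_trans[OF _ max.cobounded2]\<close>)
qed

text \<open>The base 1 + T is at least 1 even for small T, so its exponent may be raised to 1. This
  is the uniform price for replacing an exponent by a smaller one on (0,T].\<close>

lemma powr_le_one_plus:
  fixes u e T :: real
  assumes "0 < u" "u \<le> T" "0 \<le> e" "e \<le> 1"
  shows "u powr e \<le> 1 + T"
proof -
  have "u powr e \<le> (1 + T) powr e"
    using assms by (intro powr_mono2) auto
  also have "\<dots> \<le> (1 + T) powr 1"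
    using assms by (intro powr_mono) auto
  finally show ?thesis using assms by simp
qed

text \<open>Both cases rest on ln y \<le> y - 1: with y = u^(-\<delta>) for u \<le> 1, and with y =
  u for u > 1, where u^(-\<delta>) is bounded below by 1 / (1 + T). The constant is the sum of the
  constants of the two cases.\<close>

lemma abs_ln_le_powr:
  fixes u \<delta> T :: real
  assumes u: "0 < u" "u \<le> T" and \<delta>: "0 < \<delta>" "\<delta> \<le> 1"
  shows "\<bar>ln u\<bar> \<le> (1 / \<delta> + T * (1 + T)) * u powr (- \<delta>)"
proof (cases "u \<le> 1")
  case True
  have "ln (1 / u) * \<delta> = ln ((1 / u) powr \<delta>)"
    using u by (simp add: ln_powr)
  also have "\<dots> \<le> (1 / u) powr \<delta>"
    using ln_le_minus_one[of "(1 / u) powr \<delta>"] u by simp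
  also have "(1 / u) powr \<delta> = u powr (- \<delta>)"
    using u by (simp add: powr_minus powr_divide inverse_eq_divide)
  finally have "\<bar>ln u\<bar> \<le> 1 / \<delta> * u powr (- \<delta>)"
    using u True \<delta> by (simp add: ln_div field_simps)
  also have "\<dots> \<le> (1 / \<delta> + T * (1 + T)) * u powr (- \<delta>)"
    using u by (intro mult_right_mono) auto
  finally show ?thesis .
next
  case False
  have "1 = u powr \<delta> * u powr (- \<delta>)"
    using u by (simp add: powr_add[symmetric])
  also have "\<dots> \<le> (1 + T) * u powr (- \<delta>)"
    using u \<delta> by (intro mult_right_mono powr_le_one_plus) auto
  finally have 1: "1 \<le> (1 + T) * u powr (- \<delta>)" .
  have "\<bar>ln u\<bar> \<le> T * 1"
    using ln_le_minus_one[of u] u False by simp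
  also have "\<dots> \<le> T * ((1 + T) * u powr (- \<delta>))"
    using 1 u by (intro mult_left_mono) auto
  also have "\<dots> \<le> (1 / \<delta> + T * (1 + T)) * u powr (- \<delta>)"
    using u \<delta> by (simp add: algebra_simps)
  finally show ?thesis .
qed

lemma Gamma_continuous_on_pos: "0 < a \<Longrightarrow> continuous_on {a..b::real} Gamma"
  by (intro continuous_on_Gamma continuous_on_id) (auto elim!: nonpos_Ints_cases)

lemma Digamma_continuous_on_pos: "0 < a \<Longrightarrow> continuous_on {a..b::real} Digamma"
  by (intro continuous_on_Polygamma) (auto elim!: nonpos_Ints_cases)

text \<open>The function of s studied here is minus the u-derivative of
  \<open>Gamma s * u powr (- s)\<close>. Its s-derivative carries the factor
  \<open>Digamma (1 + s) - ln u\<close>, bounded by a multiple of u^(-\<delta>) with \<delta> = (1 -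
  b) / 2; together with the worst power u^(-b-1) this gives the exponent -1 - (1+b)/2. A Lipschitz
  exponent later contributes a factor u, which makes it integrable.\<close>

lemma Gamma_powr_bounds:
  fixes a b T :: real
  assumes a: "0 < a" and b: "0 < b" "b < 1" and T: "0 < T"
  obtains W W1 where "0 \<le> W" "0 \<le> W1"
    "\<And>s. s \<in> {a..b} \<Longrightarrow> \<bar>Gamma (1 + s)\<bar> \<le> W"
    "\<And>s s' u. s \<in> {a..b} \<Longrightarrow> s' \<in> {a..b} \<Longrightarrow> u \<in> {0<..T} \<Longrightarrow>
      \<bar>Gamma (1 + s) * u powr (- s - 1) - Gamma (1 + s') * u powr (- s' - 1)\<bar>
        \<le> W1 * \<bar>s - s'\<bar> * u powr (- 1 - (1 + b) / 2)"
proof -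
  define \<delta> where "\<delta> = (1 - b) / 2"
  have \<delta>: "0 < \<delta>" "\<delta> \<le> 1" using b by (auto simp: \<delta>_def)
  have "continuous_on {a..b} (\<lambda>s. Gamma (1 + s))"
    using a by (intro continuous_on_compose2[OF Gamma_continuous_on_pos[of "1 + a" "1 + b"]] continuous_intros) auto
  then obtain W where W: "0 \<le> W" "\<And>s. s \<in> {a..b} \<Longrightarrow> \<bar>Gamma (1 + s)\<bar> \<le> W"
    by (rule continuous_on_Icc_bounded) blast
  have "continuous_on {a..b} (\<lambda>s. Digamma (1 + s))"
    using a by (intro continuous_on_compose2[OF Digamma_continuous_on_pos[of "1 + a" "1 + b"]] continuous_intros) auto
  then obtain W2 where W2: "0 \<le> W2" "\<And>s. s \<in> {a..b} \<Longrightarrow> \<bar>Digamma (1 + s)\<bar> \<le> W2"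
    by (rule continuous_on_Icc_bounded) blast
  define Q where "Q = W2 * (1 + T) + (1 / \<delta> + T * (1 + T))"
  have Q: "0 \<le> Q" using W2 \<delta> T by (simp add: Q_def)
  have "\<bar>Gamma (1 + s) * u powr (- s - 1) - Gamma (1 + s') * u powr (- s' - 1)\<bar>
        \<le> W * Q * (1 + T) * \<bar>s - s'\<bar> * u powr (- 1 - (1 + b) / 2)"
    if s: "s \<in> {a..b}" "s' \<in> {a..b}" and u: "u \<in> {0<..T}" for s s' u
  proof -
    let ?f = "\<lambda>s. Gamma (1 + s) * u powr (- s - 1)"
    let ?f' = "\<lambda>s. Gamma (1 + s) * (Digamma (1 + s) - ln u) * u powr (- s - 1)"
    have der: "(?f has_field_derivative ?f' r) (at r within {a..b})" if r: "r \<in> {a..b}" for r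
    proof -
      have "1 + r \<notin> \<int>\<^sub>\<le>\<^sub>0" using r a by (auto elim!: nonpos_Ints_cases)
      moreover have "((\<lambda>s. u powr (- s - 1)) has_field_derivative - ln u * u powr (- r - 1)) (at r within {a..b})"
        using u unfolding powr_def by (auto intro!: derivative_eq_intros)
      ultimately show ?thesis
        by (auto intro!: derivative_eq_intros simp: algebra_simps)
    qed
    have bound: "norm (?f' r) \<le> W * Q * (1 + T) * u powr (- 1 - (1 + b) / 2)" if r: "r \<in> {a..b}" for r
    proof -
      have "1 = u powr \<delta> * u powr (- \<delta>)"
        using u by (simp add: powr_add[symmetric])
      also have "\<dots> \<le> (1 + T) * u powr (- \<delta>)"
        using u \<delta> by (intro mult_right_mono powr_le_one_plus) auto
      finally have 1: "1 \<le> (1 + T) * u powr (- \<delta>)" .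
      have "\<bar>Digamma (1 + r) - ln u\<bar> \<le> W2 * 1 + \<bar>ln u\<bar>"
        using W2(2)[OF r] by simp
      also have "\<dots> \<le> W2 * ((1 + T) * u powr (- \<delta>)) + (1 / \<delta> + T * (1 + T)) * u powr (- \<delta>)"
        using u \<delta> 1 W2(1) by (intro add_mono mult_left_mono abs_ln_le_powr) auto
      also have "\<dots> = Q * u powr (- \<delta>)"
        by (simp add: Q_def algebra_simps)
      finally have D: "\<bar>Digamma (1 + r) - ln u\<bar> \<le> Q * u powr (- \<delta>)" .
      have "u powr (- r - 1) = u powr (b - r) * u powr (- b - 1)"
        using u by (simp add: powr_add[symmetric])
      also have "\<dots> \<le> (1 + T) * u powr (- b - 1)"
        using u r a b by (intro mult_right_mono powr_le_one_plus) auto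
      finally have E: "u powr (- r - 1) \<le> (1 + T) * u powr (- b - 1)" .
      have "norm (?f' r) \<le> W * (Q * u powr (- \<delta>)) * ((1 + T) * u powr (- b - 1))"
        unfolding real_norm_def abs_mult
        using W(2)[OF r] D E W(1) Q T by (intro mult_mono mult_nonneg_nonneg) auto
      also have "\<dots> = W * Q * (1 + T) * (u powr (- \<delta>) * u powr (- b - 1))"
        by simp
      also have "u powr (- \<delta>) * u powr (- b - 1) = u powr (- 1 - (1 + b) / 2)"
        by (simp add: powr_add[symmetric] \<delta>_def field_simps)
      finally show ?thesis .
    qed
    show ?thesis
      using field_differentiable_bound[OF convex_closed_interval der bound s(1) s(2)]
      by (simp add: mult_ac)
  qed
  then show ?thesis
    using W Q T by (intro that[of W "W * Q * (1 + T)"]) auto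
qed

text \<open>At distance at most 1 a larger exponent gives a smaller power, so the fixed exponent a +
  \<epsilon> dominates all the variable ones.\<close>

lemma holder_continuous_on:
  fixes g \<beta> :: "real \<Rightarrow> real"
  assumes a: "0 < a" and \<epsilon>: "0 < \<epsilon>" and K: "0 \<le> K"
    and \<beta>: "\<And>t. \<beta> t \<in> {a..b}"
    and gH: "\<And>s t. \<bar>g s - g t\<bar> \<le> K * \<bar>s - t\<bar> powr (max (\<beta> s) (\<beta> t) + \<epsilon>)"
  shows "continuous_on UNIV g"
  unfolding continuous_on_def
proof
  fix x
  have "((\<lambda>y. K * \<bar>y - x\<bar> powr (a + \<epsilon>)) \<longlongrightarrow> K * \<bar>x - x\<bar> powr (a + \<epsilon>)) (at x)"
    using a \<epsilon> by (intro tendsto_intros tendsto_powr') auto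
  then have lim: "((\<lambda>y. K * \<bar>y - x\<bar> powr (a + \<epsilon>)) \<longlongrightarrow> 0) (at x)" by simp
  have "\<forall>\<^sub>F y in at x. norm (g y - g x) \<le> K * \<bar>y - x\<bar> powr (a + \<epsilon>)"
    using eventually_at_ball[OF zero_less_one, of x UNIV]
  proof eventually_elim
    case (elim y)
    have "\<bar>y - x\<bar> \<le> 1" using elim by (auto simp: dist_real_def)
    then have "\<bar>y - x\<bar> powr (max (\<beta> y) (\<beta> x) + \<epsilon>) \<le> \<bar>y - x\<bar> powr (a + \<epsilon>)"
      using \<beta>[of y] by (intro powr_mono') auto
    then show ?case
      using order_trans[OF gH[of y x] mult_left_mono[OF _ K]] by simp
  qed
  then have "((\<lambda>y. g y - g x) \<longlongrightarrow> 0) (at x)"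
    by (rule Lim_null_comparison[OF _ lim])
  then show "(g \<longlongrightarrow> g x) (at x within UNIV)"
    using LIM_zero_iff by blast
qed

text \<open>The constant is quantified before \<open>g\<close> and \<open>K\<close>, since
  \<open>K\<close> will be the norm of \<open>g\<close> and the final bound must be uniform.
  Everything lives on the whole line, so that the shifted argument y - u needs no case distinction
  at 0.\<close>

lemma fractional_integral_derivative:
  fixes a b T A L \<epsilon> :: real and \<beta> :: "real \<Rightarrow> real"
  assumes a: "0 < a" and b: "b < 1" and T: "0 < T" and \<epsilon>: "0 < \<epsilon>" and A: "0 \<le> A"
    and \<beta>: "\<And>t. \<beta> t \<in> {a..b}" and lip: "\<And>s t. \<bar>\<beta> s - \<beta> t\<bar> \<le> L * \<bar>s - t\<bar>"
  shows "\<exists>c\<ge>0. \<forall>g K. 0 \<le> K \<longrightarrow> (\<forall>t\<le>0. g t = 0) \<longrightarrow> (\<forall>t. \<bar>g t\<bar> \<le> K * A) \<longrightarrow>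
      (\<forall>s t. \<bar>g s - g t\<bar> \<le> K * \<bar>s - t\<bar> powr (max (\<beta> s) (\<beta> t) + \<epsilon>)) \<longrightarrow>
      (\<exists>D. continuous_on {0..T} D \<and> (\<forall>x\<in>{0..T}. \<bar>D x\<bar> \<le> c * K) \<and>
        (\<forall>x\<in>{0..T}. ((\<lambda>x. LBINT t:{0..<x}. Gamma (\<beta> t) * g t / (x - t) powr \<beta> t)
          has_vector_derivative D x) (at x within {0..T})))"
proof -
  have b0: "0 < b" using a \<beta>[of 0] by auto
  obtain W W1 where W: "0 \<le> W" "0 \<le> W1"
    and GW: "\<And>s. s \<in> {a..b} \<Longrightarrow> \<bar>Gamma (1 + s)\<bar> \<le> W"
    and GW1: "\<And>s s' u. s \<in> {a..b} \<Longrightarrow> s' \<in> {a..b} \<Longrightarrow> u \<in> {0<..T} \<Longrightarrow>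
      \<bar>Gamma (1 + s) * u powr (- s - 1) - Gamma (1 + s') * u powr (- s' - 1)\<bar>
        \<le> W1 * \<bar>s - s'\<bar> * u powr (- 1 - (1 + b) / 2)"
    using Gamma_powr_bounds[OF a b0 b T] by blast
  have "continuous_on {a..b} (\<lambda>s. Gamma s * T powr (- s))"
    using a T by (intro continuous_intros Gamma_continuous_on_pos) auto
  then obtain W3 where W3: "0 \<le> W3" "\<And>s. s \<in> {a..b} \<Longrightarrow> \<bar>Gamma s * T powr (- s)\<bar> \<le> W3"
    by (rule continuous_on_Icc_bounded) blast
  have L: "0 \<le> L" using lip[of 0 1] by simp
  define \<kappa> where "\<kappa> = (1 + b) / 2"
  have \<kappa>: "0 < \<kappa>" "\<kappa> < 1" using b0 b by (auto simp: \<kappa>_def)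
  have two_\<kappa>: "- 2 * \<kappa> = - b - 1" by (simp add: \<kappa>_def)
  \<comment> \<open>Write \<psi>(t) for P(t,u) without its factor g(t). Then P(y,u) - P(y-u,u) =
    (g(y) - g(y-u)) \<psi>(y) + g(y-u) (\<psi>(y) - \<psi>(y-u)). The first term is controlled by
    the regularity of g, the second by the Lipschitz continuity of the exponent; the two summands of
    \<open>\<Psi>1\<close> are their bounds divided by \<open>K\<close>.\<close>
  define \<Psi>1 where "\<Psi>1 u = W * (1 + T) * u powr (\<epsilon> - 1) + A * W1 * L * u powr (- \<kappa>)" for u
  have \<Psi>1_int: "set_integrable lborel {0<..T} \<Psi>1"
    unfolding \<Psi>1_def using \<epsilon> \<kappa> T
    by (intro set_integral_add set_integrable_mult_right set_integrable_lborel_powr) auto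
  have \<Psi>1_nonneg: "0 \<le> \<Psi>1 u" for u
    using W A L T by (simp add: \<Psi>1_def)
  \<comment> \<open>\<open>A * W3\<close> bounds the boundary term H(y,T), the integral bounds the
    difference term, both per unit of \<open>K\<close>.\<close>
  define c where "c = A * W3 + (LBINT u:{0<..T}. \<Psi>1 u)"
  have "0 \<le> (LBINT u:{0<..T}. \<Psi>1 u)"
    unfolding set_lebesgue_integral_def using \<Psi>1_nonneg by (intro Bochner_Integration.integral_nonneg) auto
  then have c: "0 \<le> c" using A W3 by (simp add: c_def)
  have cont_\<beta>: "continuous_on UNIV \<beta>"
    by (rule lipschitz_on_continuous_on[of L]) (use lip L in \<open>auto simp: lipschitz_on_def dist_real_def\<close>)
  have cont_Gamma: "continuous_on UNIV (\<lambda>t. Gamma (\<beta> t))" "continuous_on UNIV (\<lambda>t. Gamma (1 + \<beta> t))"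
    using \<beta> a
    by (intro continuous_on_compose2[OF Gamma_continuous_on_pos[of a b] cont_\<beta>]
        continuous_on_compose2[OF Gamma_continuous_on_pos[of "1 + a" "1 + b"]] continuous_intros cont_\<beta>;
        force)+
  show ?thesis
  proof (intro exI[of _ c] conjI c allI impI)
    fix g :: "real \<Rightarrow> real" and K :: real
    assume K: "0 \<le> K" and zero: "\<forall>t\<le>0. g t = 0" and bounded: "\<forall>t. \<bar>g t\<bar> \<le> K * A"
      and holder: "\<forall>s t. \<bar>g s - g t\<bar> \<le> K * \<bar>s - t\<bar> powr (max (\<beta> s) (\<beta> t) + \<epsilon>)"
    note g0 = zero[rule_format] and gA = bounded[rule_format] and gH = holder[rule_format]
    define H where "H t u = Gamma (\<beta> t) * g t * u powr (- \<beta> t)" for t u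
    define P where "P t u = g t * (Gamma (1 + \<beta> t) * u powr (- \<beta> t - 1))" for t u
    define D where "D y = H y T + (LBINT u:{0<..T}. P y u - P (y - u) u)" for y

    have cont_g: "continuous_on UNIV g"
      using holder_continuous_on[OF a \<epsilon> K \<beta> gH] .

    have 1: "((\<lambda>u. H t u) has_real_derivative - P t u) (at u)" if "0 < u" for t u
    proof -
      have "\<beta> t \<noteq> 0" "\<beta> t \<notin> \<int>\<^sub>\<le>\<^sub>0" using \<beta>[of t] a by (auto elim!: nonpos_Ints_cases)
      then have "Gamma (1 + \<beta> t) = \<beta> t * Gamma (\<beta> t)"
        using Gamma_plus1[of "\<beta> t"] by (simp add: add.commute)
      then show ?thesis
        unfolding H_def P_def using that
        by (auto intro!: derivative_eq_intros simp: powr_diff field_simps)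
    qed
    have 2: "continuous_on UNIV (\<lambda>t. H t T)"
      unfolding H_def using T by (intro continuous_intros cont_Gamma cont_g cont_\<beta>) auto
    have 3: "continuous_on (UNIV \<times> {0<..}) (\<lambda>(t, u). P t u)"
    proof -
      have fst: "continuous_on (UNIV \<times> {0<..}) (\<lambda>z. f (fst z))" if "continuous_on UNIV f"
        for f :: "real \<Rightarrow> real"
        by (rule continuous_on_compose2[OF that]) (auto intro: continuous_intros)
      show ?thesis
        unfolding P_def case_prod_beta
        by (intro continuous_intros fst cont_Gamma cont_g cont_\<beta>) auto
    qed
    have shift: "u powr (- \<beta> t - 1) \<le> (1 + T) * u powr (- b - 1)" if u: "u \<in> {0<..T}" for t u
    proof -
      have "u powr (- \<beta> t - 1) = u powr (b - \<beta> t) * u powr (- b - 1)"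
        by (simp add: powr_add[symmetric])
      also have "\<dots> \<le> (1 + T) * u powr (- b - 1)"
        using u \<beta>[of t] a b by (intro mult_right_mono powr_le_one_plus) auto
      finally show ?thesis .
    qed
    have 4: "\<bar>P t u\<bar> \<le> (K * A * (W * (1 + T))) * u powr (- 2 * \<kappa>)" if u: "u \<in> {0<..T}" for t u
    proof -
      have "\<bar>P t u\<bar> \<le> (K * A) * (W * ((1 + T) * u powr (- b - 1)))"
        unfolding P_def abs_mult using gA GW[OF \<beta>] shift[OF u] K A W T
        by (intro mult_mono mult_nonneg_nonneg) auto
      also have "\<dots> = (K * A * (W * (1 + T))) * u powr (- 2 * \<kappa>)"
        by (simp only: two_\<kappa> mult.assoc)
      finally show ?thesis .
    qed
    have 5: "\<bar>P y u - P (y - u) u\<bar> \<le> K * \<Psi>1 u" if u: "u \<in> {0<..T}" for y u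
    proof -
      let ?\<psi> = "\<lambda>t. Gamma (1 + \<beta> t) * u powr (- \<beta> t - 1)"
      let ?m = "max (\<beta> y) (\<beta> (y - u))"
      have "\<bar>(g y - g (y - u)) * ?\<psi> y\<bar> \<le> (K * u powr (?m + \<epsilon>)) * (W * u powr (- \<beta> y - 1))"
        unfolding abs_mult using gH[of y "y - u"] GW[OF \<beta>] K W u by (intro mult_mono) auto
      also have "\<dots> = K * W * (u powr (?m + \<epsilon>) * u powr (- \<beta> y - 1))"
        by (simp only: mult_ac)
      also have "u powr (?m + \<epsilon>) * u powr (- \<beta> y - 1) = u powr (?m - \<beta> y) * u powr (\<epsilon> - 1)"
        unfolding powr_add[symmetric] by (rule arg_cong[where f = "(powr) u"]) simp
      \<comment> \<open>Here the maximum in the regularity exponent pays off: ?m - \<beta> y is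
        nonnegative, so the variable exponents cancel up to a bounded factor and \<epsilon> - 1
        remains.\<close>
      also have "K * W * (u powr (?m - \<beta> y) * u powr (\<epsilon> - 1)) \<le> K * W * ((1 + T) * u powr (\<epsilon> - 1))"
        using K W u \<beta>[of y] \<beta>[of "y - u"] a b
        by (intro mult_left_mono mult_right_mono powr_le_one_plus) auto
      finally have I: "\<bar>(g y - g (y - u)) * ?\<psi> y\<bar> \<le> K * W * ((1 + T) * u powr (\<epsilon> - 1))" .
      have "\<bar>?\<psi> y - ?\<psi> (y - u)\<bar> \<le> W1 * \<bar>\<beta> y - \<beta> (y - u)\<bar> * u powr (- 1 - \<kappa>)"
        unfolding \<kappa>_def using GW1[OF \<beta> \<beta> u] by simp
      also have "\<dots> \<le> W1 * (L * u) * u powr (- 1 - \<kappa>)"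
        using lip[of y "y - u"] u W by (intro mult_right_mono mult_left_mono) auto
      also have "\<dots> = W1 * L * (u powr 1 * u powr (- 1 - \<kappa>))"
        using u by simp
      also have "\<dots> = W1 * L * u powr (- \<kappa>)"
        by (simp only: powr_add[symmetric]) simp
      finally have "\<bar>g (y - u) * (?\<psi> y - ?\<psi> (y - u))\<bar> \<le> (K * A) * (W1 * L * u powr (- \<kappa>))"
        unfolding abs_mult using gA[of "y - u"] K A by (intro mult_mono) auto
      moreover have "P y u - P (y - u) u = (g y - g (y - u)) * ?\<psi> y + g (y - u) * (?\<psi> y - ?\<psi> (y - u))"
        by (simp add: P_def algebra_simps)
      ultimately have "\<bar>P y u - P (y - u) u\<bar>
          \<le> K * W * ((1 + T) * u powr (\<epsilon> - 1)) + (K * A) * (W1 * L * u powr (- \<kappa>))"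
        using I by linarith
      then show ?thesis by (simp add: \<Psi>1_def algebra_simps)
    qed
    have K\<Psi>1: "set_integrable lborel {0<..T} (\<lambda>u. K * \<Psi>1 u)"
      using \<Psi>1_int by (rule set_integrable_mult_right)
    have P0: "P t u = 0" if "t \<le> 0" for t u
      using g0[OF that] by (simp add: P_def)
    note main = singular_convolution_derivative[where H = H and P = P and C = "K * A * (W * (1 + T))"
        and \<Psi> = "\<lambda>u. K * \<Psi>1 u", OF T \<kappa> _ 2 3 _ _ K\<Psi>1, folded D_def]
    have D_cont: "continuous_on {0..T} D"
      by (rule main(1)) (simp_all only: 1 P0 4 5)
    have D_deriv: "((\<lambda>x. LBINT t:{0..<x}. H t (x - t)) has_vector_derivative D x) (at x within {0..T})"
      if "x \<in> {0..T}" for x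
      by (rule main(2)) (simp_all only: 1 P0 4 5 that)
    have D_bound: "\<bar>D x\<bar> \<le> c * K" for x
    proof -
      have "\<bar>H x T\<bar> = \<bar>g x\<bar> * \<bar>Gamma (\<beta> x) * T powr (- \<beta> x)\<bar>"
        by (simp add: H_def abs_mult mult_ac)
      also have "\<dots> \<le> (K * A) * W3"
        using gA W3 \<beta> K A by (intro mult_mono) auto
      finally have I: "\<bar>H x T\<bar> \<le> K * A * W3" .
      have "\<bar>LBINT u:{0<..T}. P x u - P (x - u) u\<bar> \<le> (LBINT u:{0<..T}. K * \<Psi>1 u)"
        unfolding set_lebesgue_integral_def
      proof (rule order_trans[OF integral_abs_bound integral_mono'])
        show "integrable lborel (\<lambda>u. indicator {0<..T} u *\<^sub>R (K * \<Psi>1 u))"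
          using K\<Psi>1 by (simp add: set_integrable_def)
      qed (use 5 K \<Psi>1_nonneg in \<open>auto simp: indicator_def\<close>)
      also have "\<dots> = K * (LBINT u:{0<..T}. \<Psi>1 u)" by simp
      finally have "\<bar>D x\<bar> \<le> K * A * W3 + K * (LBINT u:{0<..T}. \<Psi>1 u)"
        unfolding D_def using I by linarith
      then show ?thesis by (simp add: c_def algebra_simps)
    qed
    have eq: "(LBINT t:{0..<x}. H t (x - t)) = (LBINT t:{0..<x}. Gamma (\<beta> t) * g t / (x - t) powr \<beta> t)" for x
      unfolding H_def by (intro set_lebesgue_integral_cong) (auto simp: powr_minus divide_inverse)
    show "\<exists>D. continuous_on {0..T} D \<and> (\<forall>x\<in>{0..T}. \<bar>D x\<bar> \<le> c * K) \<and>
        (\<forall>x\<in>{0..T}. ((\<lambda>x. LBINT t:{0..<x}. Gamma (\<beta> t) * g t / (x - t) powr \<beta> t)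
          has_vector_derivative D x) (at x within {0..T}))"
      using D_cont D_deriv D_bound unfolding eq by (intro exI[of _ D]) auto
  qed
qed

section \<open>Volterra equations with bounded kernel\<close>

lemma integrable_lborel_indicator_Icc: "integrable lborel (indicator {a..b::real} :: real \<Rightarrow> real)"
  by (rule integrable_real_indicator) (auto simp: emeasure_lborel_Icc_eq)

lemma integrable_lborel_power_Icc:
  "integrable lborel (\<lambda>s. s ^ n * indicator {a..b::real} s :: real)"
proof -
  have "set_integrable lborel {a..b} (\<lambda>s. s ^ n)"
    by (rule borel_integrable_atLeastAtMost') (intro continuous_intros)
  then show ?thesis by (simp add: set_integrable_def mult.commute)
qed

text \<open>The zero extension encodes the triangle 0 < s < x \<le> T in the kernel itself, so that
  no integral needs a variable domain and ordered chains of variables need no indicator.\<close>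

locale volterra_kernel =
  fixes T M :: real and k :: "real \<Rightarrow> real \<Rightarrow> real"
  assumes T_nonneg: "0 \<le> T"
    and k_measurable [measurable]: "(\<lambda>(s, x). k s x) \<in> borel_measurable (borel \<Otimes>\<^sub>M borel)"
    and k_bound: "\<bar>k s x\<bar> \<le> M"
    and k_zero: "\<not> (0 < s \<and> s < x \<and> x \<le> T) \<Longrightarrow> k s x = 0"
begin

definition volterra :: "(real \<Rightarrow> real) \<Rightarrow> real \<Rightarrow> real" where
  "volterra u x = (LBINT s. u s * k s x)"

lemma M_nonneg: "0 \<le> M"
  using k_bound[of 0 0] by simp

lemma k_measurable1 [measurable]: "(\<lambda>s. k s x) \<in> borel_measurable borel"
  by measurable

lemma volterra_measurable [measurable]:
  assumes [measurable]: "u \<in> borel_measurable borel"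
  shows "volterra u \<in> borel_measurable borel"
proof -
  have "(\<lambda>x. LBINT s. u s * k s x) \<in> borel_measurable borel"
    by measurable
  then show ?thesis
    by (simp add: volterra_def[abs_def])
qed

lemma iterate_measurable [measurable]:
  assumes [measurable]: "u \<in> borel_measurable borel"
  shows "(volterra ^^ m) u \<in> borel_measurable borel"
  by (induction m) auto

lemma volterra_integrable:
  assumes [measurable]: "u \<in> borel_measurable borel"
    and u: "\<And>s. s \<in> {0..T} \<Longrightarrow> \<bar>u s\<bar> \<le> B"
  shows "integrable lborel (\<lambda>s. u s * k s x)"
proof (rule Bochner_Integration.integrable_bound)
  show "integrable lborel (\<lambda>s. (B * M) * indicator {0..T} s)"
    by (intro integrable_mult_right integrable_lborel_indicator_Icc)
  have "\<bar>u s * k s x\<bar> \<le> B * M * indicator {0..T} s" for s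
  proof (cases "s \<in> {0..T}")
    case True
    have "\<bar>u s\<bar> * \<bar>k s x\<bar> \<le> B * M"
      using u[OF True] k_bound[of s x] by (intro mult_mono) auto
    then show ?thesis using True by (simp add: abs_mult)
  next
    case False
    then have "k s x = 0" by (intro k_zero) auto
    then show ?thesis using False by simp
  qed
  then show "AE s in lborel. norm (u s * k s x) \<le> norm ((B * M) * indicator {0..T} s)"
    by (intro AE_I2) (auto intro: order_trans[OF _ abs_ge_self])
qed measurable

text \<open>Only s < x contributes, so one application raises the power of x by one and divides by
  the new exponent. Iterating from a constant bound yields the factorials of the exponential series;
  a supremum bound alone would give only a geometric series.\<close>

lemma volterra_power_bound:
  assumes [measurable]: "u \<in> borel_measurable borel"
    and u: "\<And>s. s \<in> {0..T} \<Longrightarrow> \<bar>u s\<bar> \<le> B * s ^ n" and x: "x \<in> {0..T}"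
  shows "\<bar>volterra u x\<bar> \<le> B * M * x ^ Suc n / Suc n"
proof -
  have pointwise: "\<bar>u s * k s x\<bar> \<le> (B * M) * (s ^ n * indicator {0..x} s)" for s
  proof (cases "s \<in> {0..x}")
    case True
    then have s: "s \<in> {0..T}" using x by auto
    have "\<bar>u s\<bar> * \<bar>k s x\<bar> \<le> (B * s ^ n) * M"
      using u[OF s] k_bound[of s x] by (intro mult_mono) auto
    then show ?thesis using True by (simp add: abs_mult mult_ac)
  next
    case False
    then have "k s x = 0" by (intro k_zero) auto
    then show ?thesis using False by simp
  qed
  have int: "integrable lborel (\<lambda>s. (B * M) * (s ^ n * indicator {0..x} s))"
    by (intro integrable_mult_right integrable_lborel_power_Icc)
  have "\<bar>volterra u x\<bar> \<le> (LBINT s. (B * M) * (s ^ n * indicator {0..x} s))"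
    unfolding volterra_def real_norm_def[symmetric]
  proof (rule Bochner_Integration.integral_norm_bound_integral[OF _ int])
    show "norm (u s * k s x) \<le> (B * M) * (s ^ n * indicator {0..x} s)" for s
      using pointwise by simp
    then show "integrable lborel (\<lambda>s. u s * k s x)"
      by (intro Bochner_Integration.integrable_bound[OF int] AE_I2)
        (measurable, auto intro: order_trans[OF _ abs_ge_self])
  qed
  also have "\<dots> = B * M * (x ^ Suc n / Suc n)"
    using x by (simp add: integral_power)
  finally show ?thesis by simp
qed

lemma volterra_outside: "x \<notin> {0..T} \<Longrightarrow> volterra u x = 0"
  unfolding volterra_def by (subst k_zero) auto

lemma iterate_bound:
  assumes [measurable]: "u \<in> borel_measurable borel"
    and u: "\<And>s. s \<in> {0..T} \<Longrightarrow> \<bar>u s\<bar> \<le> B" and x: "x \<in> {0..T}"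
  shows "\<bar>(volterra ^^ m) u x\<bar> \<le> B * (M * x) ^ m / fact m"
  using x
proof (induction m arbitrary: x)
  case 0
  then show ?case using u by simp
next
  case (Suc m)
  have "\<bar>volterra ((volterra ^^ m) u) x\<bar> \<le> (B * M ^ m / fact m) * M * x ^ Suc m / Suc m"
    using Suc by (intro volterra_power_bound) (auto simp: power_mult_distrib field_simps)
  also have "\<dots> = B * (M * x) ^ Suc m / fact (Suc m)"
    by (simp add: power_mult_distrib field_simps)
  finally show ?case by simp
qed

lemma iterate_bound_T:
  assumes "u \<in> borel_measurable borel"
    and u: "\<And>s. s \<in> {0..T} \<Longrightarrow> \<bar>u s\<bar> \<le> B" and x: "x \<in> {0..T}"
  shows "\<bar>(volterra ^^ m) u x\<bar> \<le> B * ((M * T) ^ m / fact m)"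
proof -
  have "0 \<le> B" using u[of x] x by auto
  have "\<bar>(volterra ^^ m) u x\<bar> \<le> B * (M * x) ^ m / fact m"
    by (rule iterate_bound) (use assms in auto)
  also have "\<dots> \<le> B * (M * T) ^ m / fact m"
    using x M_nonneg \<open>0 \<le> B\<close>
    by (intro divide_right_mono mult_left_mono power_mono) auto
  finally show ?thesis by simp
qed

lemma summable_exp_T: "summable (\<lambda>m. B * ((M * T) ^ m / fact m))"
  using summable_exp[of "M * T"] by (intro summable_mult) (simp add: divide_inverse mult.commute)

text \<open>The value 0 off [0,T] makes a product with the indicator of [0,T] invisible when
  integrals over [0,x] are compared with \<open>volterra\<close>.\<close>

definition neumann :: "(real \<Rightarrow> real) \<Rightarrow> real \<Rightarrow> real" where
  "neumann u x = (if x \<in> {0..T} then \<Sum>m. (volterra ^^ m) u x else 0)"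

context
  fixes G :: "real \<Rightarrow> real" and B :: real
  assumes G_meas [measurable]: "G \<in> borel_measurable borel"
    and G_bound: "\<And>s. s \<in> {0..T} \<Longrightarrow> \<bar>G s\<bar> \<le> B"
begin

lemma summable_iterate: "x \<in> {0..T} \<Longrightarrow> summable (\<lambda>m. (volterra ^^ m) G x)"
  using iterate_bound_T[OF G_meas G_bound]
  by (intro summable_comparison_test[OF _ summable_exp_T[of B]]) auto

lemma neumann_measurable [measurable]: "neumann G \<in> borel_measurable borel"
  unfolding neumann_def[abs_def] by measurable

lemma B_nonneg: "0 \<le> B"
  using G_bound[of 0] T_nonneg by auto

lemma exp_T: "(\<Sum>m. B * ((M * T) ^ m / fact m)) = B * exp (M * T)"
  using summable_exp[of "M * T"]
  by (subst suminf_mult) (simp_all add: exp_def divide_inverse mult.commute)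

lemma partial_sum_bound: "x \<in> {0..T} \<Longrightarrow> \<bar>\<Sum>m<N. (volterra ^^ m) G x\<bar> \<le> B * exp (M * T)"
proof -
  assume x: "x \<in> {0..T}"
  have "\<bar>\<Sum>m<N. (volterra ^^ m) G x\<bar> \<le> (\<Sum>m<N. B * ((M * T) ^ m / fact m))"
    using iterate_bound_T[OF G_meas G_bound x] by (intro order_trans[OF sum_abs] sum_mono) 
  also have "\<dots> \<le> (\<Sum>m. B * ((M * T) ^ m / fact m))"
    using B_nonneg M_nonneg T_nonneg by (intro sum_le_suminf summable_exp_T) auto
  finally show ?thesis by (simp only: exp_T)
qed

text \<open>The terms are dominated by those of B exp(M T), so the error is at most the remainder of
  that series. It does not depend on x, hence passes directly to the L^p norm; N = 0 is the bound on
  the whole sum.\<close>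

lemma neumann_tail:
  assumes x: "x \<in> {0..T}"
  shows "\<bar>neumann G x - (\<Sum>m<N. (volterra ^^ m) G x)\<bar>
      \<le> B * exp (M * T) - (\<Sum>m<N. B * ((M * T) ^ m / fact m))"
proof -
  have "neumann G x - (\<Sum>m<N. (volterra ^^ m) G x) = (\<Sum>m. (volterra ^^ (m + N)) G x)"
    using suminf_minus_initial_segment[OF summable_iterate[OF x], of N] x by (simp add: neumann_def)
  also have "\<bar>\<dots>\<bar> \<le> (\<Sum>m. B * ((M * T) ^ (m + N) / fact (m + N)))"
    unfolding real_norm_def[symmetric]
  proof (rule norm_suminf_le)
    show "norm ((volterra ^^ (m + N)) G x) \<le> B * ((M * T) ^ (m + N) / fact (m + N))" for m
      using iterate_bound_T[OF G_meas G_bound x, of "m + N"] by simp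
    show "summable (\<lambda>m. B * ((M * T) ^ (m + N) / fact (m + N)))"
      by (rule summable_ignore_initial_segment[OF summable_exp_T[of B]])
  qed
  also have "\<dots> = B * exp (M * T) - (\<Sum>m<N. B * ((M * T) ^ m / fact m))"
    using suminf_minus_initial_segment[OF summable_exp_T[of B], of N] by (simp only: exp_T)
  finally show ?thesis .
qed

lemma tail_tendsto: "(\<lambda>N. B * exp (M * T) - (\<Sum>m<N. B * ((M * T) ^ m / fact m))) \<longlonglongrightarrow> 0"
proof -
  have "(\<lambda>N. \<Sum>m<N. B * ((M * T) ^ m / fact m)) \<longlonglongrightarrow> B * exp (M * T)"
    using summable_LIMSEQ[OF summable_exp_T[of B]] by (simp only: exp_T)
  from tendsto_diff[OF tendsto_const[of "B * exp (M * T)"] this] show ?thesis by simp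
qed

lemma neumann_bound: "x \<in> {0..T} \<Longrightarrow> \<bar>neumann G x\<bar> \<le> B * exp (M * T)"
  using neumann_tail[of x 0] by simp

lemma neumann_LIMSEQ: "x \<in> {0..T} \<Longrightarrow> (\<lambda>N. \<Sum>m<N. (volterra ^^ m) G x) \<longlonglongrightarrow> neumann G x"
  using summable_LIMSEQ[OF summable_iterate] by (simp add: neumann_def)

lemma neumann_solves:
  assumes x: "x \<in> {0..T}"
  shows "neumann G x = G x + volterra (neumann G) x"
proof -
  let ?S = "\<lambda>N s. \<Sum>m<N. (volterra ^^ m) G s"
  have bnd: "\<bar>(volterra ^^ m) G s\<bar> \<le> B * ((M * T) ^ m / fact m)" if "s \<in> {0..T}" for m s
    using iterate_bound_T[OF G_meas G_bound that] .
  \<comment> \<open>The operator shifts partial sums, V(S_N) = S_(N+1) - G. Letting N tend to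
    infinity on both sides, with dominated convergence inside V, gives the equation.\<close>
  have VS: "volterra (?S N) x = ?S (Suc N) x - G x" for N
  proof -
    have "volterra (?S N) x = (LBINT s. \<Sum>m<N. (volterra ^^ m) G s * k s x)"
      unfolding volterra_def by (simp add: sum_distrib_right)
    also have "\<dots> = (\<Sum>m<N. LBINT s. (volterra ^^ m) G s * k s x)"
      using volterra_integrable[OF iterate_measurable[OF G_meas] bnd]
      by (intro Bochner_Integration.integral_sum) 
    also have "\<dots> = (\<Sum>m<N. (volterra ^^ Suc m) G x)"
      by (simp add: volterra_def)
    finally show ?thesis
      by (simp add: sum.lessThan_Suc_shift del: sum.lessThan_Suc)
  qed
  have "(\<lambda>N. LBINT s. ?S N s * k s x) \<longlonglongrightarrow> (LBINT s. neumann G s * k s x)"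
  proof (rule integral_dominated_convergence[where w = "\<lambda>s. (B * exp (M * T) * M) * indicator {0..T} s"])
    show "integrable lborel (\<lambda>s. (B * exp (M * T) * M) * indicator {0..T} s :: real)"
      by (intro integrable_mult_right integrable_lborel_indicator_Icc)
    have "(\<lambda>N. ?S N s * k s x) \<longlonglongrightarrow> neumann G s * k s x" for s
    proof (cases "s \<in> {0..T}")
      case True
      then show ?thesis by (intro tendsto_mult neumann_LIMSEQ) auto
    next
      case False
      then have "k s x = 0" by (intro k_zero) auto
      then show ?thesis by simp
    qed
    then show "AE s in lborel. (\<lambda>N. ?S N s * k s x) \<longlonglongrightarrow> neumann G s * k s x" by simp
    have "\<bar>?S N s * k s x\<bar> \<le> B * exp (M * T) * M * indicator {0..T} s" for N s
    proof (cases "s \<in> {0..T}")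
      case True
      have "\<bar>?S N s\<bar> * \<bar>k s x\<bar> \<le> B * exp (M * T) * M"
        using partial_sum_bound[OF True] k_bound B_nonneg by (intro mult_mono) auto
      then show ?thesis using True by (simp add: abs_mult)
    next
      case False
      then have "k s x = 0" by (intro k_zero) auto
      then show ?thesis using False by simp
    qed
    then show "AE s in lborel. norm (?S N s * k s x) \<le> B * exp (M * T) * M * indicator {0..T} s" for N
      by simp
  qed measurable
  then have "(\<lambda>N. ?S (Suc N) x - G x) \<longlonglongrightarrow> volterra (neumann G) x"
    using VS by (simp add: volterra_def)
  moreover have "(\<lambda>N. ?S (Suc N) x - G x) \<longlonglongrightarrow> neumann G x - G x"
    using neumann_LIMSEQ[OF x] by (intro tendsto_diff tendsto_const) (rule LIMSEQ_Suc)
  ultimately have "volterra (neumann G) x = neumann G x - G x"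
    by (rule LIMSEQ_unique)
  then show ?thesis by simp
qed

end

text \<open>This is the integrand of the series with the simplex dropped: the zeros of
  \<open>k\<close> restore it. The starting function \<open>u\<close> is kept general for the
  recursion that integrates out one variable.\<close>

definition chain :: "(real \<Rightarrow> real) \<Rightarrow> nat \<Rightarrow> real \<Rightarrow> (nat \<Rightarrow> real) \<Rightarrow> real" where
  "chain u m x s = u (s m) * (\<Prod>i\<in>{1..<m}. k (s (Suc i)) (s i)) * k (s 1) x"

text \<open>Each s i is the first argument of exactly one kernel factor, namely
  \<open>k (s 1) x\<close> or some \<open>k (s (Suc j)) (s j)\<close>, and a nonzero kernel value
  forces that argument into (0,T).\<close>

lemma chain_outside:
  assumes "m \<ge> 1" "i \<in> {1..m}" "s i \<notin> {0..T}"
  shows "chain u m x s = 0"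
proof (rule ccontr)
  assume "chain u m x s \<noteq> 0"
  then have nz: "k (s 1) x \<noteq> 0" "\<And>i. i \<in> {1..<m} \<Longrightarrow> k (s (Suc i)) (s i) \<noteq> 0"
    by (auto simp: chain_def)
  have "s i \<in> {0..T}"
  proof (cases "i = 1")
    case True
    then show ?thesis using nz(1) k_zero[of "s 1" x] by force
  next
    case False
    then obtain j where j: "i = Suc j" "j \<in> {1..<m}"
      using assms by (cases i) auto
    then show ?thesis using nz(2)[of j] k_zero[of "s (Suc j)" "s j"] by force
  qed
  with assms show False by simp
qed

text \<open>The m factors of \<open>k\<close> give M ^ m; the indicator of the cube is what makes
  the majorant integrable on the product space.\<close>

lemma chain_bound:
  assumes u: "\<And>s. \<bar>u s\<bar> \<le> B" and m: "m \<ge> 1"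
  shows "\<bar>chain u m x s\<bar> \<le> B * M ^ m * (\<Prod>i\<in>{1..m}. indicator {0..T} (s i))"
proof (cases "\<forall>i\<in>{1..m}. s i \<in> {0..T}")
  case True
  have B: "0 \<le> B" using u[of 0] by simp
  have p: "(\<Prod>i\<in>{1..<m}. \<bar>k (s (Suc i)) (s i)\<bar>) \<le> M ^ (m - 1)"
    using prod_mono[of "{1..<m}" "\<lambda>i. \<bar>k (s (Suc i)) (s i)\<bar>" "\<lambda>_. M"] k_bound by simp
  have "\<bar>chain u m x s\<bar> \<le> B * M ^ (m - 1) * M"
    unfolding chain_def abs_mult abs_prod
    using u p k_bound B M_nonneg
    by (intro mult_mono mult_nonneg_nonneg prod_nonneg) auto
  also have "\<dots> = B * M ^ m"
    using m by (cases m) auto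
  finally show ?thesis using True by simp
next
  case False
  then obtain i where "i \<in> {1..m}" "s i \<notin> {0..T}" by blast
  then show ?thesis
    using chain_outside[OF m] u[of 0] M_nonneg by (auto intro!: mult_nonneg_nonneg prod_nonneg)
qed

lemma chain_integrable:
  assumes [measurable]: "u \<in> borel_measurable borel" and u: "\<And>s. \<bar>u s\<bar> \<le> B" and m: "m \<ge> 1"
  shows "integrable (Pi\<^sub>M {1..m} (\<lambda>_. lborel)) (chain u m x)"
proof (rule Bochner_Integration.integrable_bound)
  interpret product_sigma_finite "\<lambda>_::nat. lborel :: real measure" ..
  show "integrable (Pi\<^sub>M {1..m} (\<lambda>_. lborel)) (\<lambda>s. B * M ^ m * (\<Prod>i\<in>{1..m}. indicator {0..T} (s i)))"
    by (intro integrable_mult_right product_integrable_prod integrable_lborel_indicator_Icc) auto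
  have [measurable]: "(\<lambda>s. s i) \<in> borel_measurable (Pi\<^sub>M {1..m} (\<lambda>_. lborel :: real measure))" if "i \<in> {1..m}" for i
    using measurable_component_singleton[OF that, of "\<lambda>_. lborel :: real measure"] by simp
  have "(\<lambda>s. u (s m) * (\<Prod>i\<in>{1..<m}. k (s (Suc i)) (s i)) * k (s 1) x)
      \<in> borel_measurable (Pi\<^sub>M {1..m} (\<lambda>_. lborel))"
    using m by (intro borel_measurable_times borel_measurable_prod) measurable
  then show "chain u m x \<in> borel_measurable (Pi\<^sub>M {1..m} (\<lambda>_. lborel))"
    by (simp add: chain_def[abs_def])
  show "AE s in Pi\<^sub>M {1..m} (\<lambda>_. lborel). norm (chain u m x s)
      \<le> norm (B * M ^ m * (\<Prod>i\<in>{1..m}. indicator {0..T} (s i)))"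
    using chain_bound[OF u m] by (intro AE_I2) (auto intro: order_trans[OF _ abs_ge_self])
qed

text \<open>The induction in \<open>chain_integral\<close> replaces \<open>u\<close> by
  \<open>volterra u\<close>, and the integrability used there asks for a bound on the whole line,
  not only on [0,T].\<close>

lemma volterra_bound_const:
  assumes "u \<in> borel_measurable borel" "\<And>s. \<bar>u s\<bar> \<le> B"
  shows "\<bar>volterra u x\<bar> \<le> B * M * T"
proof (cases "x \<in> {0..T}")
  case True
  have "0 \<le> B" using assms(2)[of 0] by simp
  have "\<bar>volterra u x\<bar> \<le> B * M * x"
    using volterra_power_bound[of u B 0 x] assms True by simp
  also have "\<dots> \<le> B * M * T"
    using True M_nonneg \<open>0 \<le> B\<close> by (intro mult_left_mono) auto
  finally show ?thesis .
next
  case False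
  have "0 \<le> B" using assms(2)[of 0] by simp
  then show ?thesis using volterra_outside[OF False] M_nonneg T_nonneg by simp
qed

text \<open>Integrating out the innermost variable \<open>s (Suc m)\<close> replaces \<open>u\<close> by its Volterra integral.\<close>
lemma chain_integral:
  assumes "u \<in> borel_measurable borel" and "\<And>s. \<bar>u s\<bar> \<le> B"
  shows "(LINT s|Pi\<^sub>M {1..Suc m} (\<lambda>_. lborel). chain u (Suc m) x s) = (volterra ^^ Suc m) u x"
  using assms
\<comment> \<open>\<open>u\<close> and \<open>B\<close> vary because the innermost integration turns
  them into \<open>volterra u\<close> and \<open>B * M * T\<close>.\<close>
proof (induction m arbitrary: u B)
  case 0
  interpret product_sigma_finite "\<lambda>_::nat. lborel :: real measure" ..
  note [measurable] = 0(1)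
  have "(LINT s|Pi\<^sub>M {1::nat} (\<lambda>_. lborel). u (s 1) * k (s 1) x) = (LBINT s. u s * k s x)"
    by (rule product_integral_singleton[of "\<lambda>y. u y * k y x" 1]) simp
  then show ?case by (simp add: chain_def volterra_def)
next
  case (Suc m)
  interpret product_sigma_finite "\<lambda>_::nat. lborel :: real measure" ..
  note [measurable] = Suc.prems(1)
  have eq: "{1..Suc (Suc m)} = insert (Suc (Suc m)) {1..Suc m}" by auto
  have split: "chain u (Suc (Suc m)) x (s(Suc (Suc m) := y)) =
      (u y * k y (s (Suc m))) * ((\<Prod>i\<in>{1..<Suc m}. k (s (Suc i)) (s i)) * k (s 1) x)" for s y
  proof -
    have "(\<Prod>i\<in>{1..<Suc (Suc m)}. k ((s(Suc (Suc m) := y)) (Suc i)) ((s(Suc (Suc m) := y)) i))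
        = (\<Prod>i\<in>{1..<Suc m}. k (s (Suc i)) (s i)) * k y (s (Suc m))"
      by (simp add: prod.atLeastLessThan_Suc)
    then show ?thesis by (simp add: chain_def mult_ac)
  qed
  have "(LINT s|Pi\<^sub>M {1..Suc (Suc m)} (\<lambda>_. lborel). chain u (Suc (Suc m)) x s)
      = (LINT s|Pi\<^sub>M {1..Suc m} (\<lambda>_. lborel). (LBINT y. chain u (Suc (Suc m)) x (s(Suc (Suc m) := y))))"
    using chain_integrable[OF Suc.prems, of "Suc (Suc m)" x] unfolding eq
    by (intro product_integral_insert) simp_all
  also have "\<dots> = (LINT s|Pi\<^sub>M {1..Suc m} (\<lambda>_. lborel). chain (volterra u) (Suc m) x s)"
    unfolding split integral_mult_left_zero by (simp only: chain_def volterra_def mult.assoc)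
  also have "\<dots> = (volterra ^^ Suc m) (volterra u) x"
    by (rule Suc.IH[OF volterra_measurable[OF Suc.prems(1)] volterra_bound_const[OF Suc.prems]])
  \<comment> \<open>The variable integrated first is the one next to \<open>u\<close>, so the new
    operator enters innermost in the iterate.\<close>
  finally show ?case by (simp only: funpow_Suc_right o_apply)
qed

end

text \<open>The inequality feeds on itself. Its first use bounds |d| by M times the L^1 norm J, so
  integrability suffices as a start; each further use gains the factor M x / (n + 1). Countably many
  exceptional null sets are collected before n tends to infinity.\<close>

lemma gronwall_zero_AE:
  fixes d :: "real \<Rightarrow> real"
  assumes M: "0 \<le> M" and T: "0 \<le> T"
    and d: "integrable lebesgue d"
    and ineq: "AE x in lebesgue. x \<in> {0..T} \<longrightarrow> \<bar>d x\<bar> \<le> M * (LINT s:{0..x}|lebesgue. \<bar>d s\<bar>)"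
  shows "AE x in lebesgue. x \<in> {0..T} \<longrightarrow> d x = 0"
proof -
  define J where "J = (LINT s|lebesgue. \<bar>d s\<bar>)"
  have J: "0 \<le> J" unfolding J_def by simp
  have set_int: "set_integrable lebesgue A (\<lambda>s. \<bar>d s\<bar>)" if "A \<in> sets lebesgue" for A
    using integrable_abs[OF d] that unfolding set_integrable_def
    by (intro integrable_mult_indicator) auto
  have step: "AE x in lebesgue. x \<in> {0..T} \<longrightarrow> \<bar>d x\<bar> \<le> M * J * ((M * x) ^ n / fact n)" for n
  proof (induction n)
    case 0
    have "(LINT s:{0..x}|lebesgue. \<bar>d s\<bar>) \<le> J" for x
      unfolding J_def set_lebesgue_integral_def
      by (rule integral_mono) (use set_int[of "{0..x}"] d in \<open>auto simp: set_integrable_def indicator_def\<close>)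
    then have *: "M * (LINT s:{0..x}|lebesgue. \<bar>d s\<bar>) \<le> M * J * ((M * x) ^ 0 / fact 0)" for x
      using mult_left_mono[OF _ M] by simp
    show ?case
      using ineq by eventually_elim (blast intro: order_trans *)
  next
    case (Suc n)
    have "(LINT s:{0..x}|lebesgue. \<bar>d s\<bar>) \<le> J * ((M * x) ^ Suc n / fact (Suc n))" if x: "x \<in> {0..T}" for x
    proof -
      let ?p = "\<lambda>s. M * J * (M ^ n / fact n) * (s ^ n * indicator {0..x} s)"
      have pl: "integrable lborel ?p"
        by (intro integrable_mult_right integrable_lborel_power_Icc)
      have "(LINT s:{0..x}|lebesgue. \<bar>d s\<bar>) \<le> (LINT s|lebesgue. ?p s)"
        unfolding set_lebesgue_integral_def
      proof (rule integral_mono_AE)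
        show "integrable lebesgue (\<lambda>s. indicat_real {0..x} s *\<^sub>R \<bar>d s\<bar>)"
          using set_int[of "{0..x}"] by (simp add: set_integrable_def)
        show "integrable lebesgue ?p"
          using pl by (subst integrable_completion) auto
        show "AE s in lebesgue. indicat_real {0..x} s *\<^sub>R \<bar>d s\<bar> \<le> ?p s"
          using Suc.IH
          by eventually_elim (use x in \<open>auto simp: indicator_def power_mult_distrib\<close>)
      qed
      also have "\<dots> = (LBINT s. ?p s)"
        by (rule integral_completion) measurable
      also have "\<dots> = M * J * (M ^ n / fact n) * (x ^ Suc n / Suc n)"
        using x by (simp add: integral_power)
      also have "\<dots> = J * ((M * x) ^ Suc n / fact (Suc n))"
        by (simp add: power_mult_distrib field_simps)
      finally show ?thesis .
    qed
    then have *: "M * (LINT s:{0..x}|lebesgue. \<bar>d s\<bar>) \<le> M * J * ((M * x) ^ Suc n / fact (Suc n))"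
      if "x \<in> {0..T}" for x
      using mult_left_mono[OF _ M] that by (metis mult.assoc)
    show ?case
      using ineq by eventually_elim (blast intro: order_trans *)
  qed
  have "AE x in lebesgue. \<forall>n. x \<in> {0..T} \<longrightarrow> \<bar>d x\<bar> \<le> M * J * ((M * x) ^ n / fact n)"
    unfolding AE_all_countable using step by blast
  then show ?thesis
  proof eventually_elim
    case (elim x)
    show ?case
    proof
      assume "x \<in> {0..T}"
      then have "\<bar>d x\<bar> \<le> M * J * ((M * x) ^ n / fact n)" for n
        using elim by blast
      moreover have "(\<lambda>n. M * J * ((M * x) ^ n / fact n)) \<longlonglongrightarrow> M * J * 0"
        using summable_LIMSEQ_zero[OF summable_exp[of "M * x"]]
        by (intro tendsto_mult_left) (simp add: divide_inverse mult.commute)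
      ultimately have "\<bar>d x\<bar> \<le> M * J * 0"
        by (intro LIMSEQ_le_const) auto
      then show "d x = 0" by simp
    qed
  qed
qed

section \<open>The kernel and the spaces of the theorem\<close>

text \<open>With B(s, 1-s) = Gamma(s) Gamma(1-s) / Gamma(1) the prefactor becomes a product of
  reciprocal Gamma functions, which are continuous everywhere, so no pole has to be
  excluded.\<close>

lemma inverse_Beta_eq_rGamma: "1 / Beta s (1 - s) = rGamma s * rGamma (1 - s :: real)"
  by (simp add: Beta_def rGamma_inverse_Gamma divide_inverse)

lemma C1_on_has_real_derivative:
  assumes "0 < T" "C1_on T \<alpha>" "x \<in> {0..T}"
  shows "(\<alpha> has_real_derivative deriv_on T \<alpha> x) (at x within {0..T})"
  using assms
  by (simp add: C1_on_def deriv_on_def differentiable_on_def has_real_derivative_iff_has_vector_derivative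
      vector_derivative_works[symmetric])

text \<open>Clamping the argument of \<alpha> and of its derivative to [0,T] gives a function that
  is measurable and bounded on the whole plane. The majorant in \<tau> is independent of s and x:
  the integrand is at worst logarithmic at \<tau> = 0, and of order b with a logarithm at \<tau> =
  1.\<close>

lemma F_kernel_bounded_measurable:
  assumes T: "0 < T" and C1: "C1_on T \<alpha>" and \<alpha>: "\<alpha> ` {0..T} \<subseteq> {a..b}" and a: "0 < a" and b: "b < 1"
  obtains F M where "(\<lambda>(s, x). F s x) \<in> borel_measurable (borel \<Otimes>\<^sub>M borel)"
    "\<And>s x. \<bar>F s x\<bar> \<le> M"
    "\<And>s x. s \<in> {0..T} \<Longrightarrow> x \<in> {0..T} \<Longrightarrow> F_kernel T \<alpha> s x = F s x"
proof -
  define cl where "cl t = max 0 (min T t)" for t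
  have cl: "cl t \<in> {0..T}" for t using T by (auto simp: cl_def)
  have cl_id: "cl t = t" if "t \<in> {0..T}" for t using that by (auto simp: cl_def)
  have cont_cl: "continuous_on UNIV cl" unfolding cl_def by (intro continuous_intros)
  define A where "A t = deriv_on T \<alpha> (cl t)" for t
  define \<beta> where "\<beta> t = \<alpha> (cl t)" for t
  have \<beta>: "\<beta> t \<in> {a..b}" for t using subsetD[OF \<alpha> imageI[OF cl]] by (simp only: \<beta>_def)
  have cont_\<alpha>: "continuous_on {0..T} \<alpha>"
    using C1 by (auto simp: C1_on_def intro: differentiable_imp_continuous_on)
  have cont_A: "continuous_on UNIV A"
    unfolding A_def using C1 cl by (intro continuous_on_compose2[OF _ cont_cl]) (auto simp: C1_on_def)
  have cont_\<beta>: "continuous_on UNIV \<beta>"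
    unfolding \<beta>_def using cl by (intro continuous_on_compose2[OF cont_\<alpha> cont_cl]) auto
  have [measurable]: "A \<in> borel_measurable borel" "\<beta> \<in> borel_measurable borel" "cl \<in> borel_measurable borel"
    using cont_A cont_\<beta> cont_cl by (auto intro: borel_measurable_continuous_onI)
  obtain A0 where A0: "0 \<le> A0" "\<And>s. s \<in> {0..T} \<Longrightarrow> \<bar>A s\<bar> \<le> A0"
    using continuous_on_Icc_bounded[OF continuous_on_subset[OF cont_A]] by (metis subset_UNIV)
  have A_bound: "\<bar>A t\<bar> \<le> A0" for t
    using A0(2)[OF cl[of t]] cl_id[OF cl[of t]] by (simp add: A_def)
  have "continuous_on {a..b} (\<lambda>s. rGamma s * rGamma (1 - s))"
    by (intro continuous_on_mult continuous_on_rGamma continuous_on_compose2[OF continuous_on_rGamma[of UNIV]]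
        continuous_intros) auto
  then obtain R where R: "0 \<le> R" "\<And>s. s \<in> {a..b} \<Longrightarrow> \<bar>rGamma s * rGamma (1 - s)\<bar> \<le> R"
    by (rule continuous_on_Icc_bounded) blast
  have rG [measurable]: "(rGamma :: real \<Rightarrow> real) \<in> borel_measurable borel"
    by (intro borel_measurable_continuous_onI continuous_intros)

  \<comment> \<open>\<delta> is the power spent on the logarithms; \<kappa> = \<delta> + b < 1 is
    the resulting order of the singularity.\<close>
  define \<delta> where "\<delta> = (1 - b) / 2"
  define \<kappa> where "\<kappa> = (1 + b) / 2"
  have b0: "0 < b" using \<beta>[of 0] a by auto
  have \<delta>: "0 < \<delta>" "\<delta> \<le> 1" and \<kappa>: "0 < \<kappa>" "\<kappa> < 1" and \<delta>\<kappa>: "\<kappa> = \<delta> + b"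
    using b b0 by (auto simp: \<delta>_def \<kappa>_def field_simps)
  define h where "h s x \<tau> = indicator {0<..<1} \<tau> *
     (A (s + \<tau> * (x - s)) * (ln \<tau> - ln (1 - \<tau>)) * (\<tau> / (1 - \<tau>)) powr \<beta> (s + \<tau> * (x - s)))" for s x \<tau>
  define \<theta> where "\<theta> \<tau> = indicator {0<..1} \<tau> * \<tau> powr (- \<kappa>)" for \<tau> :: real
  have \<theta>: "integrable lborel \<theta>"
    using set_integrable_lborel_powr[of "- \<kappa>" 1] \<kappa> by (simp add: set_integrable_def \<theta>_def[abs_def])
  \<comment> \<open>1 / \<delta> + 2 is the constant of \<open>abs_ln_le_powr\<close> at T = 1. The
    coefficient 2 appears because both logarithms contribute a term (1 -
    \<tau>)^(-\<kappa>).\<close>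
  define \<Theta> where "\<Theta> \<tau> = A0 * (1 / \<delta> + 2) * (\<theta> \<tau> + 2 * \<theta> (1 + (-1) * \<tau>))" for \<tau>
  have \<Theta>: "integrable lborel \<Theta>"
    unfolding \<Theta>_def
    by (intro integrable_mult_right Bochner_Integration.integrable_add \<theta> lborel_integrable_real_affine) auto
  have h_bound: "\<bar>h s x \<tau>\<bar> \<le> \<Theta> \<tau>" for s x \<tau>
  proof (cases "\<tau> \<in> {0<..<1}")
    case True
    let ?B = "\<beta> (s + \<tau> * (x - s))"
    have lns: "\<bar>ln \<tau> - ln (1 - \<tau>)\<bar> \<le> (1 / \<delta> + 2) * (\<tau> powr (- \<delta>) + (1 - \<tau>) powr (- \<delta>))"
    proof -
      have "\<bar>ln \<tau>\<bar> \<le> (1 / \<delta> + 2) * \<tau> powr (- \<delta>)" "\<bar>ln (1 - \<tau>)\<bar> \<le> (1 / \<delta> + 2) * (1 - \<tau>) powr (- \<delta>)"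
        using abs_ln_le_powr[of \<tau> 1 \<delta>] abs_ln_le_powr[of "1 - \<tau>" 1 \<delta>] True \<delta> by simp_all
      then show ?thesis
        unfolding distrib_left by linarith
    qed
    have "(\<tau> / (1 - \<tau>)) powr ?B \<le> (1 / (1 - \<tau>)) powr ?B"
      using True \<beta>[of "s + \<tau> * (x - s)"] a by (intro powr_mono2 divide_right_mono) auto
    also have "\<dots> \<le> (1 / (1 - \<tau>)) powr b"
      using True \<beta>[of "s + \<tau> * (x - s)"] by (intro powr_mono) auto
    also have "\<dots> = (1 - \<tau>) powr (- b)"
      using True by (simp add: powr_divide powr_minus_divide)
    finally have quot: "(\<tau> / (1 - \<tau>)) powr ?B \<le> (1 - \<tau>) powr (- b)" .
    \<comment> \<open>Singularities at opposite ends do not add up: evaluating both factors at the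
      smaller of \<tau> and 1 - \<tau> only increases the product.\<close>
    have "\<tau> powr (- \<delta>) * (1 - \<tau>) powr (- b) \<le> \<tau> powr (- \<kappa>) + (1 - \<tau>) powr (- \<kappa>)"
    proof (cases "\<tau> \<le> 1 - \<tau>")
      case le: True
      have "\<tau> powr (- \<delta>) * (1 - \<tau>) powr (- b) \<le> \<tau> powr (- \<delta>) * \<tau> powr (- b)"
        using True le b0 by (intro mult_left_mono powr_mono2') auto
      also have "\<dots> = \<tau> powr (- \<kappa>)" by (simp add: powr_add[symmetric] \<delta>\<kappa>)
      finally show ?thesis by (simp add: add_increasing2)
    next
      case False
      have "\<tau> powr (- \<delta>) * (1 - \<tau>) powr (- b) \<le> (1 - \<tau>) powr (- \<delta>) * (1 - \<tau>) powr (- b)"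
        using True False \<delta> by (intro mult_right_mono powr_mono2') auto
      also have "\<dots> = (1 - \<tau>) powr (- \<kappa>)" by (simp add: powr_add[symmetric] \<delta>\<kappa>)
      finally show ?thesis by (simp add: add_increasing)
    qed
    moreover have "(1 - \<tau>) powr (- \<delta>) * (1 - \<tau>) powr (- b) = (1 - \<tau>) powr (- \<kappa>)"
      by (simp add: powr_add[symmetric] \<delta>\<kappa>)
    ultimately have prod: "(\<tau> powr (- \<delta>) + (1 - \<tau>) powr (- \<delta>)) * (1 - \<tau>) powr (- b)
        \<le> \<tau> powr (- \<kappa>) + 2 * (1 - \<tau>) powr (- \<kappa>)"
      by (simp add: distrib_right)
    have "\<bar>h s x \<tau>\<bar> \<le> A0 * ((1 / \<delta> + 2) * (\<tau> powr (- \<delta>) + (1 - \<tau>) powr (- \<delta>))) * (1 - \<tau>) powr (- b)"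
      using True A_bound lns quot A0 \<delta>
      unfolding h_def abs_mult by (simp only: indicator_simps abs_one mult_1) (intro mult_mono mult_nonneg_nonneg; simp)
    also have "\<dots> = A0 * (1 / \<delta> + 2) * ((\<tau> powr (- \<delta>) + (1 - \<tau>) powr (- \<delta>)) * (1 - \<tau>) powr (- b))"
      by (simp only: mult.assoc)
    also have "\<dots> \<le> A0 * (1 / \<delta> + 2) * (\<tau> powr (- \<kappa>) + 2 * (1 - \<tau>) powr (- \<kappa>))"
      using A0 \<delta> by (intro mult_left_mono prod mult_nonneg_nonneg) auto
    also have "\<dots> = \<Theta> \<tau>"
      using True by (simp add: \<Theta>_def \<theta>_def)
    finally show ?thesis .
  next
    case False
    then show ?thesis using A0 \<delta> by (simp add: h_def \<Theta>_def \<theta>_def)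
  qed
  have h_meas [measurable]: "(\<lambda>(z, \<tau>). h (fst z) (snd z) \<tau>) \<in> borel_measurable ((borel \<Otimes>\<^sub>M borel) \<Otimes>\<^sub>M borel)"
    unfolding h_def by measurable
  define F where "F s x = - (rGamma (\<beta> x) * rGamma (1 - \<beta> x)) * (LBINT \<tau>. h s x \<tau>)" for s x
  have int_meas: "(\<lambda>z. LBINT \<tau>. h (fst z) (snd z) \<tau>) \<in> borel_measurable (borel \<Otimes>\<^sub>M borel)"
    by measurable
  show ?thesis
  proof (rule that[of F "R * (LBINT \<tau>. \<Theta> \<tau>)"])
    have "(\<lambda>z. - (rGamma (\<beta> (snd z)) * rGamma (1 - \<beta> (snd z))) * (LBINT \<tau>. h (fst z) (snd z) \<tau>))
        \<in> borel_measurable (borel \<Otimes>\<^sub>M borel)"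
      using int_meas by measurable
    then show "(\<lambda>(s, x). F s x) \<in> borel_measurable (borel \<Otimes>\<^sub>M borel)"
      by (simp add: F_def case_prod_beta')
    show "\<bar>F s x\<bar> \<le> R * (LBINT \<tau>. \<Theta> \<tau>)" for s x
    proof -
      have "\<bar>LBINT \<tau>. h s x \<tau>\<bar> \<le> (LBINT \<tau>. \<Theta> \<tau>)"
        by (rule order_trans[OF integral_abs_bound integral_mono'[OF \<Theta>]])
          (use h_bound order_trans[OF abs_ge_zero h_bound] in auto)
      then show ?thesis
        unfolding F_def abs_mult abs_minus_cancel
        using R(2)[OF \<beta>[of x]] R(1) by (intro mult_mono) (auto simp: abs_mult)
    qed
    show "F_kernel T \<alpha> s x = F s x" if s: "s \<in> {0..T}" and x: "x \<in> {0..T}" for s x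
    proof -
      have mem: "s + \<tau> * (x - s) \<in> {0..T}" if "\<tau> \<in> {0<..<1}" for \<tau>
      proof -
        have "s + \<tau> * (x - s) = (1 - \<tau>) * s + \<tau> * x" by (simp add: algebra_simps)
        moreover have "\<dots> \<in> {0..T}"
          using convexD_alt[OF convex_closed_interval[of 0 T] s x, of \<tau>] that by (simp add: algebra_simps)
        ultimately show ?thesis by simp
      qed
      have "(LINT \<tau>:{0<..<1}|lebesgue. deriv_on T \<alpha> (s + \<tau> * (x - s)) * (ln \<tau> - ln (1 - \<tau>)) *
          (\<tau> / (1 - \<tau>)) powr \<alpha> (s + \<tau> * (x - s))) = (LINT \<tau>|lebesgue. h s x \<tau>)"
        unfolding set_lebesgue_integral_def
        by (intro Bochner_Integration.integral_cong refl)
          (auto simp: h_def A_def \<beta>_def cl_id[OF mem] indicator_def)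
      also have "\<dots> = (LBINT \<tau>. h s x \<tau>)"
        by (rule integral_completion) (simp add: h_def)
      finally show ?thesis
        by (simp add: F_kernel_def F_def inverse_Beta_eq_rGamma \<beta>_def cl_id[OF x])
    qed
  qed
qed

section \<open>Bounded functions in L^p of an interval\<close>

lemma integrable_lebesgue_on_Icc_AE_bounded:
  fixes f :: "real \<Rightarrow> real"
  assumes "f \<in> borel_measurable (lebesgue_on {0..T})" "AE x in lebesgue_on {0..T}. \<bar>f x\<bar> \<le> B"
  shows "integrable (lebesgue_on {0..T}) f"
proof -
  interpret finite_measure "lebesgue_on {0..T}"
    by standard (simp add: space_restrict_space emeasure_restrict_space emeasure_lborel_Icc_eq)
  show ?thesis
    using assms by (intro integrable_const_bound[of _ B]) auto
qed

lemma in_Lp_AE_bounded: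
  assumes p: "0 \<le> p" and f: "f \<in> borel_measurable (lebesgue_on {0..T})"
    and bound: "AE x in lebesgue_on {0..T}. \<bar>f x\<bar> \<le> B"
  shows "in_Lp p T f"
  unfolding in_Lp_def
proof
  show "integrable (lebesgue_on {0..T}) (\<lambda>x. \<bar>f x\<bar> powr p)"
  proof (rule integrable_lebesgue_on_Icc_AE_bounded)
    show "AE x in lebesgue_on {0..T}. \<bar>\<bar>f x\<bar> powr p\<bar> \<le> B powr p"
      using bound by eventually_elim (use p in \<open>auto intro: powr_mono2\<close>)
  qed (use f in measurable)
qed (rule f)

lemma in_Lp_imp_integrable:
  assumes p: "1 \<le> p" and f: "in_Lp p T f"
  shows "integrable (lebesgue_on {0..T}) f"
proof (rule Bochner_Integration.integrable_bound)
  show "integrable (lebesgue_on {0..T}) (\<lambda>x. 1 + \<bar>f x\<bar> powr p)"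
    using f integrable_lebesgue_on_Icc_AE_bounded[of "\<lambda>_. 1" T 1]
    by (intro Bochner_Integration.integrable_add) (auto simp: in_Lp_def)
  have "\<bar>f x\<bar> \<le> 1 + \<bar>f x\<bar> powr p" for x
  proof (cases "\<bar>f x\<bar> \<le> 1")
    case False
    then have "\<bar>f x\<bar> powr 1 \<le> \<bar>f x\<bar> powr p" using p by (intro powr_mono) auto
    then show ?thesis by simp
  qed (simp add: add_increasing2)
  then show "AE x in lebesgue_on {0..T}. norm (f x) \<le> norm (1 + \<bar>f x\<bar> powr p)"
    by (intro AE_I2) (auto intro: order_trans[OF _ abs_ge_self])
qed (use f in \<open>simp add: in_Lp_def\<close>)

lemma Lp_norm_AE_bounded:
  assumes p: "0 < p" and T: "0 \<le> T" and e: "0 \<le> e"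
    and bound: "AE x in lebesgue_on {0..T}. \<bar>f x\<bar> \<le> e"
  shows "Lp_norm p T f \<le> T powr (1 / p) * e"
proof -
  have "(LINT x|lebesgue_on {0..T}. \<bar>f x\<bar> powr p) \<le> (LINT x|lebesgue_on {0..T}. e powr p)"
  proof (rule integral_mono_AE')
    show "integrable (lebesgue_on {0..T}) (\<lambda>x. e powr p)"
      by (rule integrable_lebesgue_on_Icc_AE_bounded[of _ _ "e powr p"]) auto
    show "AE x in lebesgue_on {0..T}. \<bar>f x\<bar> powr p \<le> e powr p"
      using bound by eventually_elim (use p in \<open>auto intro: powr_mono2\<close>)
  qed auto
  also have "\<dots> = T * e powr p"
    using T by (simp add: measure_restrict_space space_restrict_space)
  finally have "Lp_norm p T f \<le> (T * e powr p) powr (1 / p)"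
    unfolding Lp_norm_def using p by (intro powr_mono2) auto
  also have "\<dots> = T powr (1 / p) * e"
    using p T e by (simp add: powr_mult powr_powr)
  finally show ?thesis .
qed

lemma AE_lebesgue_on_Icc:
  "(AE x in lebesgue_on {0..T::real}. P x) \<longleftrightarrow> (AE x in lebesgue. x \<in> {0..T} \<longrightarrow> P x)"
  by (simp add: AE_restrict_space_iff)

lemma AE_lebesgue_neq: "AE s in lebesgue. s \<noteq> (c::real)"
  using AE_completion[OF AE_lborel_singleton[of c]] by simp

section \<open>Comparison of the cut-off kernel with the original one\<close>

context volterra_kernel
begin

text \<open>On the simplex every variable lies in (0,x), so the original data and the cut-off data
  agree. Off the simplex some order relation fails, and the kernel factor carrying it is
  zero.\<close>

lemma chain_simplex:
  assumes m: "m \<ge> 1" and x: "x \<in> {0..T}"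
    and u: "\<And>s. s \<in> {0..T} \<Longrightarrow> G0 T \<alpha> g s = u s"
    and F: "\<And>s x. 0 < s \<Longrightarrow> s < x \<Longrightarrow> x \<le> T \<Longrightarrow> F_kernel T \<alpha> s x = k s x"
  shows "indicator (decreasing_simplex m x) s *\<^sub>R series_integrand T \<alpha> g m x s = chain u m x s"
proof (cases "s \<in> decreasing_simplex m x")
  case True
  then have s: "0 < s m" "\<And>i. i \<in> {1..<m} \<Longrightarrow> s (Suc i) < s i" "s 1 < x"
    by (auto simp: decreasing_simplex_def)
  have upper: "s i < x" if "1 \<le> i" "i \<le> m" for i
    using that
  proof (induction i rule: dec_induct)
    case (step i)
    then show ?case using s(2)[of i] by auto
  qed (use s in auto)
  have lower: "0 < s i" if "i \<le> m" "1 \<le> i" for i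
    using that
  proof (induction i rule: inc_induct)
    case (step i)
    then show ?case using s(2)[of i] by auto
  qed (use s in auto)
  have "(\<Prod>i\<in>{1..<m}. F_kernel T \<alpha> (s (Suc i)) (s i)) = (\<Prod>i\<in>{1..<m}. k (s (Suc i)) (s i))"
  proof (intro prod.cong refl F)
    fix i assume i: "i \<in> {1..<m}"
    then show "0 < s (Suc i)" "s (Suc i) < s i" "s i \<le> T"
      using lower[of "Suc i"] s(2)[of i] upper[of i] x by auto
  qed
  moreover have "F_kernel T \<alpha> (s 1) x = k (s 1) x"
    using lower[of 1] s x m by (intro F) auto
  moreover have "G0 T \<alpha> g (s m) = u (s m)"
    using lower[of m] upper[of m] m x by (intro u) auto
  ultimately show ?thesis using True by (simp add: chain_def series_integrand_def)
next
  case False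
  then consider "s m \<le> 0" | i where "i \<in> {1..<m}" "\<not> s (Suc i) < s i" | "\<not> s 1 < x"
    by (auto simp: decreasing_simplex_def not_less)
  then have "chain u m x s = 0"
  proof cases
    \<comment> \<open>The factor with first argument s m vanishes: it is \<open>k (s 1) x\<close> if
      m = 1, and the last factor of the product otherwise.\<close>
    case 1
    show ?thesis
    proof (cases "m = 1")
      case True
      then show ?thesis using 1 by (simp add: chain_def k_zero)
    next
      case ne: False
      then have "m - 1 \<in> {1..<m}" "k (s (Suc (m - 1))) (s (m - 1)) = 0"
        using m 1 by (auto intro: k_zero)
      then have "(\<Prod>i\<in>{1..<m}. k (s (Suc i)) (s i)) = 0"
        by (intro prod_zero) blast+
      then show ?thesis by (simp add: chain_def)
    qed
  next
    case 2
    then have "(\<Prod>i\<in>{1..<m}. k (s (Suc i)) (s i)) = 0"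
      using k_zero by (intro prod_zero) blast+
    then show ?thesis by (simp add: chain_def)
  next
    case 3
    then show ?thesis by (simp add: chain_def k_zero)
  qed
  with False show ?thesis by simp
qed

text \<open>On [0,x] the kernels can differ only at s = 0 and s = x. Measurability of the original
  integrand is also obtained from this almost everywhere equality, by completeness of Lebesgue
  measure.\<close>

lemma integral_F_kernel:
  assumes F: "\<And>s x. 0 < s \<Longrightarrow> s < x \<Longrightarrow> x \<le> T \<Longrightarrow> F_kernel T \<alpha> s x = k s x"
    and x: "x \<in> {0..T}" and f: "f \<in> borel_measurable (lebesgue_on {0..T})"
  shows "(LINT s:{0..x}|lebesgue. f s * F_kernel T \<alpha> s x)
    = (LINT s|lebesgue. indicator {0..T} s * f s * k s x)"
proof -
  have ae: "AE s in lebesgue. indicator {0..T} s * f s * k s x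
      = indicator {0..x} s *\<^sub>R (f s * F_kernel T \<alpha> s x)"
    using AE_lebesgue_neq[of 0] AE_lebesgue_neq[of x]
  proof eventually_elim
    case (elim s)
    show ?case
    proof (cases "0 < s \<and> s < x")
      case True
      then show ?thesis using F[of s x] x by (simp add: indicator_def)
    next
      case False
      then have "k s x = 0" using k_zero[of s x] by blast
      then show ?thesis using False elim by (auto simp: indicator_def)
    qed
  qed
  have "(\<lambda>s. indicator {0..T} s * f s) \<in> borel_measurable lebesgue"
    using f by (subst (asm) borel_measurable_restrict_space_iff) auto
  moreover have "(\<lambda>s. k s x) \<in> borel_measurable lebesgue"
    by (intro measurable_completion) measurable
  ultimately have m: "(\<lambda>s. indicator {0..T} s * f s * k s x) \<in> borel_measurable lebesgue"
    by (rule borel_measurable_times)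
  have "(\<lambda>s. indicator {0..x} s *\<^sub>R (f s * F_kernel T \<alpha> s x)) \<in> borel_measurable lebesgue"
    by (rule borel_measurable_AE[OF m ae])
  then show ?thesis
    unfolding set_lebesgue_integral_def using m ae by (intro integral_cong_AE[symmetric]) auto
qed

end

section \<open>Regularity of the right-hand side and uniqueness\<close>

lemma C1_on_lipschitz:
  assumes T: "0 < T" and C1: "C1_on T \<alpha>"
  obtains L where "0 \<le> L" "\<And>s t. s \<in> {0..T} \<Longrightarrow> t \<in> {0..T} \<Longrightarrow> \<bar>\<alpha> s - \<alpha> t\<bar> \<le> L * \<bar>s - t\<bar>"
proof -
  have "continuous_on {0..T} (deriv_on T \<alpha>)" using C1 by (simp add: C1_on_def)
  then obtain L where L: "0 \<le> L" "\<And>s. s \<in> {0..T} \<Longrightarrow> \<bar>deriv_on T \<alpha> s\<bar> \<le> L"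
    by (rule continuous_on_Icc_bounded) blast
  have "\<bar>\<alpha> s - \<alpha> t\<bar> \<le> L * \<bar>s - t\<bar>" if "s \<in> {0..T}" "t \<in> {0..T}" for s t
    using field_differentiable_bound[of "{0..T}" \<alpha> "deriv_on T \<alpha>" L s t]
      C1_on_has_real_derivative[OF T C1] L that by (simp add: convex_real_interval)
  with L(1) show ?thesis by (rule that)
qed

lemma holder_norm_bound:
  assumes g: "g \<in> holder_space0 \<beta> T" and s: "s \<in> {0..T}" and t: "t \<in> {0..T}"
  shows "\<bar>g s - g t\<bar> \<le> holder_norm \<beta> T g * \<bar>s - t\<bar> powr max (\<beta> s) (\<beta> t)"
proof (cases "s = t")
  case False
  have bdd: "bdd_above (holder_quotients \<beta> T g)" and g0: "g 0 = 0"
    using g by (auto simp: holder_space0_def holder_space_def)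
  have "\<bar>g s - g t\<bar> / \<bar>s - t\<bar> powr max (\<beta> s) (\<beta> t) \<in> holder_quotients \<beta> T g"
    using s t False unfolding holder_quotients_def by blast
  then have "\<bar>g s - g t\<bar> / \<bar>s - t\<bar> powr max (\<beta> s) (\<beta> t) \<le> holder_norm \<beta> T g"
    using bdd by (simp add: holder_norm_def g0 cSup_upper)
  then show ?thesis using False by (simp add: pos_divide_le_eq)
qed simp

lemma holder_norm_nonneg:
  assumes "0 < T" and g: "g \<in> holder_space0 \<beta> T"
  shows "0 \<le> holder_norm \<beta> T g"
proof -
  have "0 \<le> holder_norm \<beta> T g * \<bar>0 - T\<bar> powr max (\<beta> 0) (\<beta> T)"
    using holder_norm_bound[OF g, of 0 T] assms by (auto intro: order_trans[OF abs_ge_zero])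
  then show ?thesis using assms by (simp add: zero_le_mult_iff)
qed

text \<open>The given functions are replaced by extensions to the line that satisfy the global
  hypotheses of \<open>fractional_integral_derivative\<close>; on [0,T] the singular integrals
  coincide, so the derivative within [0,T] is the same.\<close>

lemma G0_regular:
  assumes T: "0 < T" and C1: "C1_on T \<alpha>" and \<alpha>: "\<alpha> ` {0..T} \<subseteq> {a..b}"
    and a: "0 < a" and b: "b < 1" and \<epsilon>: "0 < \<epsilon>"
  obtains c where "0 \<le> c"
    "\<And>g. g \<in> holder_space0 (\<lambda>t. \<alpha> t + \<epsilon>) T \<Longrightarrow>
      (\<forall>x\<in>{0..T}. singular_integral \<alpha> g differentiable (at x within {0..T})) \<and>
      continuous_on {0..T} (G0 T \<alpha> g) \<and>
      (\<forall>x\<in>{0..T}. \<bar>G0 T \<alpha> g x\<bar> \<le> c * holder_norm (\<lambda>t. \<alpha> t + \<epsilon>) T g)"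
proof -
  define cl where "cl t = max 0 (min T t)" for t
  have cl: "cl t \<in> {0..T}" for t using T by (auto simp: cl_def)
  have cl_id: "cl t = t" if "t \<in> {0..T}" for t using that by (auto simp: cl_def)
  have cl_lip: "\<bar>cl s - cl t\<bar> \<le> \<bar>s - t\<bar>" for s t by (auto simp: cl_def)
  define \<beta> where "\<beta> t = \<alpha> (cl t)" for t
  have \<beta>: "\<beta> t \<in> {a..b}" for t using subsetD[OF \<alpha> imageI[OF cl]] by (simp only: \<beta>_def)
  obtain L where L: "0 \<le> L" "\<And>s t. s \<in> {0..T} \<Longrightarrow> t \<in> {0..T} \<Longrightarrow> \<bar>\<alpha> s - \<alpha> t\<bar> \<le> L * \<bar>s - t\<bar>"
    using C1_on_lipschitz[OF T C1] by blast
  have lip: "\<bar>\<beta> s - \<beta> t\<bar> \<le> L * \<bar>s - t\<bar>" for s t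
    using order_trans[OF L(2)[OF cl cl] mult_left_mono[OF cl_lip L(1)]] by (simp only: \<beta>_def)
  \<comment> \<open>Comparing with the value 0 at 0 bounds |g(t)| by K t^e with e \<le> b +
    \<epsilon>; base and exponent are rounded up to 1 + T and 1 + \<epsilon>.\<close>
  define A where "A = (1 + T) powr (1 + \<epsilon>)"
  have A: "0 \<le> A" by (simp add: A_def)
  obtain c where c: "0 \<le> c" and
    frac: "\<forall>g K. 0 \<le> K \<longrightarrow> (\<forall>t\<le>0. g t = 0) \<longrightarrow> (\<forall>t. \<bar>g t\<bar> \<le> K * A) \<longrightarrow>
      (\<forall>s t. \<bar>g s - g t\<bar> \<le> K * \<bar>s - t\<bar> powr (max (\<beta> s) (\<beta> t) + \<epsilon>)) \<longrightarrow>
      (\<exists>D. continuous_on {0..T} D \<and> (\<forall>x\<in>{0..T}. \<bar>D x\<bar> \<le> c * K) \<and>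
        (\<forall>x\<in>{0..T}. ((\<lambda>x. LBINT t:{0..<x}. Gamma (\<beta> t) * g t / (x - t) powr \<beta> t)
          has_vector_derivative D x) (at x within {0..T})))"
    using fractional_integral_derivative[OF a b T \<epsilon> A \<beta> lip] by blast
  have cont_\<alpha>: "continuous_on {0..T} \<alpha>"
    using C1 by (auto simp: C1_on_def intro: differentiable_imp_continuous_on)
  have cont_R: "continuous_on {a..b} (\<lambda>s. rGamma s * rGamma (1 - s))"
    by (intro continuous_on_mult continuous_on_rGamma continuous_on_compose2[OF continuous_on_rGamma[of UNIV]]
        continuous_intros) auto
  then obtain R where R: "0 \<le> R" "\<And>s. s \<in> {a..b} \<Longrightarrow> \<bar>rGamma s * rGamma (1 - s)\<bar> \<le> R"
    by (rule continuous_on_Icc_bounded) blast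
  show ?thesis
  proof (rule that[of "R * c"])
    show "0 \<le> R * c" using R c by simp
    fix g assume g: "g \<in> holder_space0 (\<lambda>t. \<alpha> t + \<epsilon>) T"
    define K where "K = holder_norm (\<lambda>t. \<alpha> t + \<epsilon>) T g"
    have K: "0 \<le> K" unfolding K_def using T g by (rule holder_norm_nonneg)
    have g0: "g 0 = 0" using g by (simp add: holder_space0_def)
    define h where "h t = g (cl t)" for t
    \<comment> \<open>Clamping is a contraction and the exponent is positive, so the regularity of
      \<open>g\<close> passes to \<open>h\<close> with the same constant. Since g 0 = 0, clamping is
      also the extension by 0 to the left.\<close>
    have hH: "\<bar>h s - h t\<bar> \<le> K * \<bar>s - t\<bar> powr (max (\<beta> s) (\<beta> t) + \<epsilon>)" for s t
    proof -
      have "\<bar>h s - h t\<bar> \<le> K * \<bar>cl s - cl t\<bar> powr max (\<beta> s + \<epsilon>) (\<beta> t + \<epsilon>)"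
        using holder_norm_bound[OF g cl cl] by (simp only: h_def K_def \<beta>_def)
      also have "\<dots> \<le> K * \<bar>s - t\<bar> powr max (\<beta> s + \<epsilon>) (\<beta> t + \<epsilon>)"
        using K cl_lip \<beta>[of s] a \<epsilon> by (intro mult_left_mono powr_mono2) auto
      also have "max (\<beta> s + \<epsilon>) (\<beta> t + \<epsilon>) = max (\<beta> s) (\<beta> t) + \<epsilon>"
        by (simp add: max_add_distrib_left)
      finally show ?thesis .
    qed
    have h0: "h t = 0" if "t \<le> 0" for t
      using that T g0 by (simp add: h_def cl_def)
    have hA: "\<bar>h t\<bar> \<le> K * A" for t
    proof -
      have "\<bar>h t\<bar> \<le> K * \<bar>cl t\<bar> powr (max (\<beta> t) (\<beta> 0) + \<epsilon>)"
        using hH[of "cl t" 0] h0[of 0] cl_id[OF cl[of t]] by (simp add: h_def \<beta>_def)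
      also have "\<bar>cl t\<bar> powr (max (\<beta> t) (\<beta> 0) + \<epsilon>) \<le> (1 + T) powr (max (\<beta> t) (\<beta> 0) + \<epsilon>)"
        using cl[of t] \<beta>[of t] a \<epsilon> by (intro powr_mono2) auto
      also have "\<dots> \<le> A"
        unfolding A_def using \<beta>[of t] \<beta>[of 0] b T by (intro powr_mono) auto
      finally show ?thesis using K by (simp add: mult_left_mono)
    qed
    have "\<exists>D. continuous_on {0..T} D \<and> (\<forall>x\<in>{0..T}. \<bar>D x\<bar> \<le> c * K) \<and>
        (\<forall>x\<in>{0..T}. ((\<lambda>x. LBINT t:{0..<x}. Gamma (\<beta> t) * h t / (x - t) powr \<beta> t)
          has_vector_derivative D x) (at x within {0..T}))"
      by (rule frac[rule_format]) (simp_all only: K h0 hA hH)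
    then obtain D where D: "continuous_on {0..T} D" "\<And>x. x \<in> {0..T} \<Longrightarrow> \<bar>D x\<bar> \<le> c * K"
      and deriv: "\<And>x. x \<in> {0..T} \<Longrightarrow> ((\<lambda>x. LBINT t:{0..<x}. Gamma (\<beta> t) * h t / (x - t) powr \<beta> t)
          has_vector_derivative D x) (at x within {0..T})"
      by blast
    have cont_h: "continuous_on UNIV h"
      using holder_continuous_on[OF a \<epsilon> K \<beta> hH] .
    have cont_\<beta>: "continuous_on UNIV \<beta>"
      unfolding \<beta>_def
      by (rule continuous_on_compose2[OF cont_\<alpha>]) (use cl in \<open>auto simp: cl_def intro!: continuous_intros\<close>)
    have cont_G: "continuous_on UNIV (\<lambda>t. Gamma (\<beta> t))"
      using \<beta> a by (intro continuous_on_compose2[OF Gamma_continuous_on_pos[of a b] cont_\<beta>]) auto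
    have [measurable]: "h \<in> borel_measurable borel" "\<beta> \<in> borel_measurable borel"
        "(\<lambda>t. Gamma (\<beta> t)) \<in> borel_measurable borel"
      using cont_h cont_\<beta> cont_G by (auto intro: borel_measurable_continuous_onI)
    have sing: "singular_integral \<alpha> g x = (LBINT t:{0..<x}. Gamma (\<beta> t) * h t / (x - t) powr \<beta> t)"
      if x: "x \<in> {0..T}" for x
    proof -
      \<comment> \<open>At t = x the integrand is a quotient by \<open>0 powr \<alpha> x\<close> =
        0, hence 0, so the closed and the half-open interval give the same function.\<close>
      have "singular_integral \<alpha> g x
          = (LINT t|lebesgue. indicator {0..<x} t *\<^sub>R (Gamma (\<beta> t) * h t / (x - t) powr \<beta> t))"
        unfolding singular_integral_def set_lebesgue_integral_def
        using x by (intro Bochner_Integration.integral_cong refl)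
          (auto simp: indicator_def \<beta>_def h_def cl_id less_le)
      also have "\<dots> = (LBINT t:{0..<x}. Gamma (\<beta> t) * h t / (x - t) powr \<beta> t)"
        unfolding set_lebesgue_integral_def by (rule integral_completion) measurable
      finally show ?thesis .
    qed
    have deriv': "(singular_integral \<alpha> g has_vector_derivative D x) (at x within {0..T})"
      if x: "x \<in> {0..T}" for x
      by (rule has_vector_derivative_transform[OF x sing deriv[OF x]])
    have G0_eq: "G0 T \<alpha> g x = rGamma (\<alpha> x) * rGamma (1 - \<alpha> x) * D x" if x: "x \<in> {0..T}" for x
    proof -
      have "deriv_on T (singular_integral \<alpha> g) x = D x"
        unfolding deriv_on_def using x T deriv'[OF x] by (intro vector_derivative_within_closed_interval) auto
      then show ?thesis by (simp add: G0_def inverse_Beta_eq_rGamma)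
    qed
    have "continuous_on {0..T} (\<lambda>x. rGamma (\<alpha> x) * rGamma (1 - \<alpha> x) * D x)"
      using \<alpha> by (intro continuous_on_mult D(1) continuous_on_compose2[OF cont_R cont_\<alpha>, simplified])
    then have "continuous_on {0..T} (G0 T \<alpha> g)"
      by (rule continuous_on_eq) (simp add: G0_eq)
    moreover have "\<bar>G0 T \<alpha> g x\<bar> \<le> R * c * K" if x: "x \<in> {0..T}" for x
    proof -
      have "\<bar>rGamma (\<alpha> x) * rGamma (1 - \<alpha> x)\<bar> * \<bar>D x\<bar> \<le> R * (c * K)"
        using R(1) R(2)[OF subsetD[OF \<alpha> imageI[OF x]]] D(2)[OF x] by (intro mult_mono) auto
      then show ?thesis by (simp add: G0_eq[OF x] abs_mult mult.assoc)
    qed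
    ultimately show "(\<forall>x\<in>{0..T}. singular_integral \<alpha> g differentiable (at x within {0..T})) \<and>
      continuous_on {0..T} (G0 T \<alpha> g) \<and>
      (\<forall>x\<in>{0..T}. \<bar>G0 T \<alpha> g x\<bar> \<le> R * c * holder_norm (\<lambda>t. \<alpha> t + \<epsilon>) T g)"
      using differentiableI_vector[OF deriv'] by (auto simp: K_def)
  qed
qed

lemma space_lebesgue_on: "space (lebesgue_on {0..T::real}) = {0..T}"
  by (simp add: space_restrict_space)


text \<open>\<open>G0\<close> cancels in the difference d of two solutions, leaving |d(x)| \<le> M
  int_0^x |d|. On a bounded interval L^p lies in L^1, which is what \<open>gronwall_zero_AE\<close>
  starts from.\<close>

lemma multifractional_solution_unique:
  assumes T: "0 < T" and p: "1 \<le> p"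
    and vk: "volterra_kernel T M k"
    and F: "\<And>s x. 0 < s \<Longrightarrow> s < x \<Longrightarrow> x \<le> T \<Longrightarrow> F_kernel T \<alpha> s x = k s x"
    and f1: "multifractional_solution T \<alpha> p g f1" and f2: "multifractional_solution T \<alpha> p g f2"
  shows "AE x in lebesgue_on {0..T}. f1 x = f2 x"
proof -
  interpret volterra_kernel T M k by (rule vk)
  have m: "f1 \<in> borel_measurable (lebesgue_on {0..T})" "f2 \<in> borel_measurable (lebesgue_on {0..T})"
    using f1 f2 by (auto simp: multifractional_solution_def in_Lp_def)
  define d where "d x = indicator {0..T} x * f1 x - indicator {0..T} x * f2 x" for x
  have int: "integrable lebesgue (\<lambda>x. indicator {0..T} x * f x)" if "multifractional_solution T \<alpha> p g f" for f
  proof -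
    have "integrable (lebesgue_on {0..T}) f"
      using that p by (intro in_Lp_imp_integrable[of p]) (auto simp: multifractional_solution_def)
    then show ?thesis
      by (subst (asm) integrable_restrict_space) auto
  qed
  have d: "integrable lebesgue d"
    unfolding d_def using int[OF f1] int[OF f2] by (rule Bochner_Integration.integrable_diff)
  have times_k: "\<bar>r * k s x\<bar> \<le> M * \<bar>r\<bar>" for r s x
    using mult_right_mono[OF k_bound[of s x] abs_ge_zero[of r]] by (simp add: abs_mult mult.commute[of "\<bar>r\<bar>"])
  have k_int: "integrable lebesgue (\<lambda>s. indicator {0..T} s * f s * k s x)"
    if "multifractional_solution T \<alpha> p g f" for f x
  proof (rule Bochner_Integration.integrable_bound)
    show "integrable lebesgue (\<lambda>s. M * (indicator {0..T} s * f s))"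
      using int[OF that] by simp
    have "(\<lambda>s. k s x) \<in> borel_measurable lebesgue"
      by (intro measurable_completion) measurable
    then show "(\<lambda>s. indicator {0..T} s * f s * k s x) \<in> borel_measurable lebesgue"
      by (rule borel_measurable_times[OF borel_measurable_integrable[OF int[OF that]]])
    show "AE s in lebesgue. norm (indicator {0..T} s * f s * k s x) \<le> norm (M * (indicator {0..T} s * f s))"
    proof (rule AE_I2)
      fix s
      show "norm (indicator {0..T} s * f s * k s x) \<le> norm (M * (indicator {0..T} s * f s))"
        using times_k[of "indicator {0..T} s * f s" s x] M_nonneg by (simp add: abs_mult)
    qed
  qed
  have eq: "AE x in lebesgue. x \<in> {0..T} \<longrightarrow>
      f x = G0 T \<alpha> g x + (LINT s|lebesgue. indicator {0..T} s * f s * k s x)"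
    if f: "multifractional_solution T \<alpha> p g f" for f
  proof -
    have "AE x in lebesgue. x \<in> {0..T} \<longrightarrow>
        f x = G0 T \<alpha> g x + (LINT s:{0..x}|lebesgue. f s * F_kernel T \<alpha> s x)"
      using f by (simp only: multifractional_solution_def AE_lebesgue_on_Icc)
    then show ?thesis
      by eventually_elim (use integral_F_kernel[OF F, where f = f] f in
          \<open>auto simp: multifractional_solution_def in_Lp_def\<close>)
  qed
  have "AE x in lebesgue. x \<in> {0..T} \<longrightarrow> \<bar>d x\<bar> \<le> M * (LINT s:{0..x}|lebesgue. \<bar>d s\<bar>)"
    using eq[OF f1] eq[OF f2]
  proof eventually_elim
    case (elim x)
    show ?case
    proof
      assume x: "x \<in> {0..T}"
      have "d x = (LINT s|lebesgue. indicator {0..T} s * f1 s * k s x)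
          - (LINT s|lebesgue. indicator {0..T} s * f2 s * k s x)"
        using elim x by (simp add: d_def)
      also have "\<dots> = (LINT s|lebesgue. d s * k s x)"
        using k_int[OF f1] k_int[OF f2]
        by (subst Bochner_Integration.integral_diff[symmetric]) (simp_all add: d_def algebra_simps)
      finally have "\<bar>d x\<bar> \<le> (LINT s|lebesgue. \<bar>d s * k s x\<bar>)"
        by (simp only: integral_abs_bound)
      also have "\<dots> \<le> (LINT s|lebesgue. M * (indicator {0..x} s *\<^sub>R \<bar>d s\<bar>))"
      proof (rule integral_mono')
        show "integrable lebesgue (\<lambda>s. M * (indicator {0..x} s *\<^sub>R \<bar>d s\<bar>))"
          using integrable_mult_indicator[of "{0..x}" lebesgue "\<lambda>s. \<bar>d s\<bar>"] d by simp
        show "\<bar>d s * k s x\<bar> \<le> M * (indicator {0..x} s *\<^sub>R \<bar>d s\<bar>)" for s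
        proof (cases "0 < s \<and> s < x")
          case True
          then show ?thesis using times_k[of "d s" s x] by simp
        next
          case False
          then have "k s x = 0" using k_zero by blast
          then show ?thesis using M_nonneg by simp
        qed
      qed (use M_nonneg in simp)
      finally show "\<bar>d x\<bar> \<le> M * (LINT s:{0..x}|lebesgue. \<bar>d s\<bar>)"
        by (simp add: set_lebesgue_integral_def)
    qed
  qed
  from gronwall_zero_AE[OF M_nonneg T_nonneg d this] show ?thesis
    unfolding AE_lebesgue_on_Icc by eventually_elim (auto simp: d_def)
qed

theorem theorem9:
  fixes T a b \<epsilon> :: real and \<alpha> :: "real \<Rightarrow> real"
  assumes "T > 0"
    and "{a..b} \<subseteq> {0<..<1}"
    and "C1_on T \<alpha>" and "\<alpha> ` {0..T} \<subseteq> {a..b}"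
    and "0 < \<epsilon>" and "\<epsilon> < 1 - (SUP t\<in>{0..T}. \<alpha> t)"
  shows "\<exists>C :: real \<Rightarrow> real.
    (\<forall>p>1. ((INF t\<in>{0..T}. \<alpha> t) + \<epsilon> - \<alpha> 0) * p > -1 \<longrightarrow> in_Lp p T C) \<and>
    (\<forall>p>1. ((INF t\<in>{0..T}. \<alpha> t) + \<epsilon> - \<alpha> 0) * p > -1 \<longrightarrow>
      (\<forall>g \<in> holder_space0 (\<lambda>t. \<alpha> t + \<epsilon>) T.
        (AE x in lebesgue_on {0..T}.
           singular_integral \<alpha> g differentiable (at x within {0..T})) \<and>
        multifractional_solution T \<alpha> p g (multifractional_deriv T \<alpha> p g) \<and>
        (\<forall>f. multifractional_solution T \<alpha> p g f \<longrightarrow>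
           (AE x in lebesgue_on {0..T}. f x = multifractional_deriv T \<alpha> p g x)) \<and>
        (\<forall>m\<ge>1. AE x in lebesgue_on {0..T}.
           set_integrable (Pi\<^sub>M {1..m} (\<lambda>_. lborel)) (decreasing_simplex m x)
             (series_integrand T \<alpha> g m x)) \<and>
        Lp_sums p T (\<lambda>n. series_term T \<alpha> g (Suc n))
          (\<lambda>x. multifractional_deriv T \<alpha> p g x - G0 T \<alpha> g x) \<and>
        (AE x in lebesgue_on {0..T}.
           \<bar>multifractional_deriv T \<alpha> p g x\<bar> \<le> C x * holder_norm (\<lambda>t. \<alpha> t + \<epsilon>) T g) \<and>
        in_Lp p T (multifractional_deriv T \<alpha> p g)))"
proof -
  \<comment> \<open>This shows that [a,b] is nonempty, without which its inclusion in (0,1) says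
    nothing about a and b.\<close>
  have "\<alpha> 0 \<in> {a..b}"
    using assms(1) by (intro subsetD[OF assms(4) imageI]) simp
  then have "a \<in> {a..b}" "b \<in> {a..b}" by auto
  with assms(2) have a: "0 < a" and b: "b < 1" by (meson greaterThanLessThan_iff subsetD)+
  note T = assms(1) and C1 = assms(3) and \<alpha> = assms(4) and \<epsilon> = assms(5)
  obtain c where c: "0 \<le> c"
    and G0: "\<And>g. g \<in> holder_space0 (\<lambda>t. \<alpha> t + \<epsilon>) T \<Longrightarrow>
      (\<forall>x\<in>{0..T}. singular_integral \<alpha> g differentiable (at x within {0..T})) \<and>
      continuous_on {0..T} (G0 T \<alpha> g) \<and>
      (\<forall>x\<in>{0..T}. \<bar>G0 T \<alpha> g x\<bar> \<le> c * holder_norm (\<lambda>t. \<alpha> t + \<epsilon>) T g)"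
    using G0_regular[OF T C1 \<alpha> a b \<epsilon>] by blast
  obtain F M where F_meas [measurable]: "(\<lambda>(s, x). F s x) \<in> borel_measurable (borel \<Otimes>\<^sub>M borel)"
    and F_bound: "\<And>s x. \<bar>F s x\<bar> \<le> M"
    and F_eq: "\<And>s x. s \<in> {0..T} \<Longrightarrow> x \<in> {0..T} \<Longrightarrow> F_kernel T \<alpha> s x = F s x"
    using F_kernel_bounded_measurable[OF T C1 \<alpha> a b] by blast
  define k where "k s x = (if 0 < s \<and> s < x \<and> x \<le> T then F s x else 0)" for s x
  interpret volterra_kernel T M k
  proof
    show "(\<lambda>(s, x). k s x) \<in> borel_measurable (borel \<Otimes>\<^sub>M borel)"
      unfolding k_def by measurable
    show "\<bar>k s x\<bar> \<le> M" for s x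
      using F_bound[of s x] order_trans[OF abs_ge_zero F_bound[of s x]] by (auto simp: k_def)
  qed (use T in \<open>auto simp: k_def\<close>)
  have F_k: "F_kernel T \<alpha> s x = k s x" if "0 < s" "s < x" "x \<le> T" for s x
    using that F_eq[of s x] by (simp add: k_def)
  show ?thesis
  \<comment> \<open>\<open>c\<close> times the norm of g bounds G0(g), and exp(M T) is the
    amplification by the Neumann series; neither factor depends on g or p.\<close>
  proof (rule exI[of _ "\<lambda>_. c * exp (M * T)"], intro conjI; intro allI impI)
    fix p :: real assume "p > 1"
    then show "in_Lp p T (\<lambda>_. c * exp (M * T))"
      by (intro in_Lp_AE_bounded[of p _ T "\<bar>c * exp (M * T)\<bar>"]) auto
  next
    fix p :: real assume p: "p > 1"
    show "\<forall>g \<in> holder_space0 (\<lambda>t. \<alpha> t + \<epsilon>) T.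
        (AE x in lebesgue_on {0..T}.
           singular_integral \<alpha> g differentiable (at x within {0..T})) \<and>
        multifractional_solution T \<alpha> p g (multifractional_deriv T \<alpha> p g) \<and>
        (\<forall>f. multifractional_solution T \<alpha> p g f \<longrightarrow>
           (AE x in lebesgue_on {0..T}. f x = multifractional_deriv T \<alpha> p g x)) \<and>
        (\<forall>m\<ge>1. AE x in lebesgue_on {0..T}.
           set_integrable (Pi\<^sub>M {1..m} (\<lambda>_. lborel)) (decreasing_simplex m x)
             (series_integrand T \<alpha> g m x)) \<and>
        Lp_sums p T (\<lambda>n. series_term T \<alpha> g (Suc n))
          (\<lambda>x. multifractional_deriv T \<alpha> p g x - G0 T \<alpha> g x) \<and>
        (AE x in lebesgue_on {0..T}.
           \<bar>multifractional_deriv T \<alpha> p g x\<bar>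
             \<le> c * exp (M * T) * holder_norm (\<lambda>t. \<alpha> t + \<epsilon>) T g) \<and>
        in_Lp p T (multifractional_deriv T \<alpha> p g)"
    proof
      fix g assume g: "g \<in> holder_space0 (\<lambda>t. \<alpha> t + \<epsilon>) T"
      define K where "K = holder_norm (\<lambda>t. \<alpha> t + \<epsilon>) T g"
      have K: "0 \<le> K" unfolding K_def using T g by (rule holder_norm_nonneg)
      define B where "B = c * K"
      have B: "0 \<le> B" using c K by (simp add: B_def)
      \<comment> \<open>Off [0,T] nothing is known about \<open>G0\<close>; the cut-off is Borel and
        bounded on the whole line.\<close>
      define G where "G x = indicator {0..T} x *\<^sub>R G0 T \<alpha> g x" for x
      have G_meas [measurable]: "G \<in> borel_measurable borel"
        unfolding G_def using G0[OF g] by (intro borel_measurable_continuous_on_indicator) auto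
      have G_bound: "\<bar>G x\<bar> \<le> B" for x
        using G0[OF g] B by (auto simp: G_def B_def K_def indicator_def)
      have G_eq: "G0 T \<alpha> g x = G x" if "x \<in> {0..T}" for x
        using that by (simp add: G_def)
      have to_leb: "f \<in> borel_measurable (lebesgue_on {0..T})" if "f \<in> borel_measurable borel" for f :: "real \<Rightarrow> real"
        using that by (intro measurable_restrict_space1 measurable_completion) simp
      have AE_Icc: "AE x in lebesgue_on {0..T}. P x" if "\<forall>x\<in>{0..T}. P x" for P
        using that by (intro AE_I2) (simp add: space_restrict_space)
      let ?f = "neumann G"
      let ?D = "multifractional_deriv T \<alpha> p g"
      have f_meas: "?f \<in> borel_measurable (lebesgue_on {0..T})"
        by (intro to_leb neumann_measurable[OF G_meas G_bound])
      have f_bound: "\<forall>x\<in>{0..T}. \<bar>?f x\<bar> \<le> B * exp (M * T)"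
        using neumann_bound[OF G_meas G_bound] by blast
      have f_sol: "multifractional_solution T \<alpha> p g ?f"
        unfolding multifractional_solution_def
      proof
        show "in_Lp p T ?f"
          using p f_meas AE_Icc[OF f_bound] by (intro in_Lp_AE_bounded) auto
        show "AE x in lebesgue_on {0..T}.
          ?f x = G0 T \<alpha> g x + (LINT s:{0..x}|lebesgue. ?f s * F_kernel T \<alpha> s x)"
        proof (intro AE_Icc ballI)
          fix x assume x: "x \<in> {0..T}"
          have [measurable]: "?f \<in> borel_measurable borel"
            by (rule neumann_measurable[OF G_meas G_bound])
          have "(LINT s:{0..x}|lebesgue. ?f s * F_kernel T \<alpha> s x)
              = (LINT s|lebesgue. indicator {0..T} s * ?f s * k s x)"
            using F_k x f_meas by (rule integral_F_kernel)
          also have "\<dots> = (LBINT s. indicator {0..T} s * ?f s * k s x)"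
            by (rule integral_completion) measurable
          also have "\<dots> = volterra ?f x"
            unfolding volterra_def by (intro Bochner_Integration.integral_cong refl) (simp add: neumann_def)
          finally show "?f x = G0 T \<alpha> g x + (LINT s:{0..x}|lebesgue. ?f s * F_kernel T \<alpha> s x)"
            using neumann_solves[OF G_meas G_bound x] G_eq[OF x] by simp
        qed
      qed
      \<comment> \<open>The Neumann sum witnesses existence, so the choice operator does return a
        solution.\<close>
      have D_sol: "multifractional_solution T \<alpha> p g ?D"
        unfolding multifractional_deriv_def using f_sol
        by (rule someI[where P = "multifractional_solution T \<alpha> p g"])
      then have D_Lp: "in_Lp p T ?D" by (simp add: multifractional_solution_def)
      have unique: "AE x in lebesgue_on {0..T}. f x = ?D x" if "multifractional_solution T \<alpha> p g f" for f
        using multifractional_solution_unique[OF T _ volterra_kernel_axioms F_k that D_sol] p by simp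
      have D_f: "AE x in lebesgue_on {0..T}. ?D x = ?f x"
        using unique[OF f_sol] by eventually_elim simp
      have chain_eq: "indicator (decreasing_simplex m x) s *\<^sub>R series_integrand T \<alpha> g m x s = chain G m x s"
        if "m \<ge> 1" "x \<in> {0..T}" for m x s
        using that G_eq F_k by (rule chain_simplex)
      have term_eq: "series_term T \<alpha> g (Suc n) x = (volterra ^^ Suc n) G x" if "x \<in> {0..T}" for n x
        unfolding series_term_def set_lebesgue_integral_def
        using chain_integral[OF G_meas G_bound, of n x] chain_eq[OF _ that, of "Suc n"] by simp
      have term_Lp: "in_Lp p T (series_term T \<alpha> g (Suc n))" for n
      proof (rule in_Lp_AE_bounded)
        have "(volterra ^^ Suc n) G \<in> borel_measurable (lebesgue_on {0..T})"
          by (intro to_leb iterate_measurable G_meas)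
        then show "series_term T \<alpha> g (Suc n) \<in> borel_measurable (lebesgue_on {0..T})"
          by (rule measurable_cong[THEN iffD1, rotated]) (simp only: term_eq space_lebesgue_on)
        show "AE x in lebesgue_on {0..T}. \<bar>series_term T \<alpha> g (Suc n) x\<bar> \<le> B * ((M * T) ^ Suc n / fact (Suc n))"
          using iterate_bound_T[OF G_meas G_bound] by (intro AE_Icc ballI) (simp only: term_eq)
      qed (use p in simp)
      \<comment> \<open>Remainder of the exponential series. The term m = 0 of the Neumann series is
        \<open>G0\<close> itself, so subtracting \<open>G0\<close> and N terms of the series leaves
        \<open>e (Suc N)\<close>.\<close>
      define e where "e N = B * exp (M * T) - (\<Sum>m<N. B * ((M * T) ^ m / fact m))" for N
      have tail: "AE x in lebesgue_on {0..T}.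
          \<bar>(?D x - G0 T \<alpha> g x) - (\<Sum>n<N. series_term T \<alpha> g (Suc n) x)\<bar> \<le> e (Suc N)" for N
      proof -
        have "\<forall>x\<in>{0..T}. \<bar>(?f x - G0 T \<alpha> g x) - (\<Sum>n<N. series_term T \<alpha> g (Suc n) x)\<bar> \<le> e (Suc N)"
        proof
          fix x assume x: "x \<in> {0..T}"
          have "(?f x - G0 T \<alpha> g x) - (\<Sum>n<N. series_term T \<alpha> g (Suc n) x)
              = ?f x - (\<Sum>m<Suc N. (volterra ^^ m) G x)"
            unfolding sum.lessThan_Suc_shift using G_eq[OF x] by (simp add: term_eq[OF x] del: funpow.simps(2))
          then show "\<bar>(?f x - G0 T \<alpha> g x) - (\<Sum>n<N. series_term T \<alpha> g (Suc n) x)\<bar> \<le> e (Suc N)"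
            using neumann_tail[OF G_meas G_bound x, of "Suc N"] by (simp only: e_def)
        qed
        from AE_Icc[OF this] D_f show ?thesis
          by eventually_elim (simp only:)
      qed
      have e_nonneg: "0 \<le> e N" for N
        using neumann_tail[OF G_meas G_bound, of 0 N] T unfolding e_def
        by (auto intro: order_trans[OF abs_ge_zero])
      have diff_Lp: "in_Lp p T (\<lambda>x. ?D x - G0 T \<alpha> g x)"
      proof (rule in_Lp_AE_bounded)
        have "(\<lambda>x. ?D x - G x) \<in> borel_measurable (lebesgue_on {0..T})"
          using D_Lp to_leb[OF G_meas] by (intro borel_measurable_diff) (auto simp: in_Lp_def)
        then show "(\<lambda>x. ?D x - G0 T \<alpha> g x) \<in> borel_measurable (lebesgue_on {0..T})"
          by (rule measurable_cong[THEN iffD1, rotated]) (simp only: G_eq space_lebesgue_on)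
        show "AE x in lebesgue_on {0..T}. \<bar>?D x - G0 T \<alpha> g x\<bar> \<le> e (Suc 0)"
          using tail[of 0] by simp
      qed (use p in simp)
      have "(\<lambda>N. T powr (1 / p) * e (Suc N)) \<longlonglongrightarrow> T powr (1 / p) * 0"
        using LIMSEQ_Suc[OF tail_tendsto[OF G_meas G_bound]] unfolding e_def by (intro tendsto_mult_left)
      then have lim: "(\<lambda>N. T powr (1 / p) * e (Suc N)) \<longlonglongrightarrow> 0" by simp
      have "(\<lambda>N. Lp_norm p T (\<lambda>x. (?D x - G0 T \<alpha> g x) - (\<Sum>n<N. series_term T \<alpha> g (Suc n) x))) \<longlonglongrightarrow> 0"
      proof (rule tendsto_sandwich[OF _ _ tendsto_const lim])
        show "\<forall>\<^sub>F N in sequentially. 0 \<le> Lp_norm p T (\<lambda>x. (?D x - G0 T \<alpha> g x) - (\<Sum>n<N. series_term T \<alpha> g (Suc n) x))"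
          by (simp add: Lp_norm_def)
        show "\<forall>\<^sub>F N in sequentially. Lp_norm p T (\<lambda>x. (?D x - G0 T \<alpha> g x) - (\<Sum>n<N. series_term T \<alpha> g (Suc n) x))
            \<le> T powr (1 / p) * e (Suc N)"
          using p T by (intro always_eventually allI Lp_norm_AE_bounded tail e_nonneg) auto
      qed
      then have sums: "Lp_sums p T (\<lambda>n. series_term T \<alpha> g (Suc n)) (\<lambda>x. ?D x - G0 T \<alpha> g x)"
        using term_Lp diff_Lp by (simp add: Lp_sums_def)
      have int: "AE x in lebesgue_on {0..T}.
           set_integrable (Pi\<^sub>M {1..m} (\<lambda>_. lborel)) (decreasing_simplex m x) (series_integrand T \<alpha> g m x)"
        if "m \<ge> 1" for m
        using chain_integrable[OF G_meas G_bound that] chain_eq[OF that]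
        by (intro AE_Icc ballI) (simp only: set_integrable_def)
      have bound: "AE x in lebesgue_on {0..T}. \<bar>?D x\<bar> \<le> c * exp (M * T) * holder_norm (\<lambda>t. \<alpha> t + \<epsilon>) T g"
        using D_f AE_Icc[OF f_bound] by eventually_elim (simp add: B_def K_def mult_ac)
      have diff: "AE x in lebesgue_on {0..T}. singular_integral \<alpha> g differentiable (at x within {0..T})"
        using G0[OF g] by (intro AE_Icc) (rule conjunct1)
      show "(AE x in lebesgue_on {0..T}.
           singular_integral \<alpha> g differentiable (at x within {0..T})) \<and>
        multifractional_solution T \<alpha> p g ?D \<and>
        (\<forall>f. multifractional_solution T \<alpha> p g f \<longrightarrow> (AE x in lebesgue_on {0..T}. f x = ?D x)) \<and>
        (\<forall>m\<ge>1. AE x in lebesgue_on {0..T}.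
           set_integrable (Pi\<^sub>M {1..m} (\<lambda>_. lborel)) (decreasing_simplex m x)
             (series_integrand T \<alpha> g m x)) \<and>
        Lp_sums p T (\<lambda>n. series_term T \<alpha> g (Suc n)) (\<lambda>x. ?D x - G0 T \<alpha> g x) \<and>
        (AE x in lebesgue_on {0..T}.
           \<bar>?D x\<bar> \<le> c * exp (M * T) * holder_norm (\<lambda>t. \<alpha> t + \<epsilon>) T g) \<and>
        in_Lp p T ?D"
        by (intro conjI allI impI diff D_sol unique int sums bound D_Lp)
    qed
  qed
qed

end
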